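(* Let $\mathbf p=(p_k)_{k\ge0}$ be a probability mass function on $\{0,1,2,\dots\}$ and $Z\sim\mathbf p$. Assume $\mathbb E[Z]<\infty$, $p_0\in(0,1)$, $p_0+p_1<1$ and $\gcd\{j:p_j>0\}=1$. Fix $k\ge1$ and let $\deg(v_k,n)$ denote the degree of vertex $v_k$ in $\mathcal T_n(\mathbf p)$. Then for any $\delta>0$, as $n\to\infty$, $$\frac{\deg(v_k,n)}{n^{\frac1R-\delta}}\xrightarrow{a.s.}\infty\qquad\text{and}\qquad\frac{\deg(v_k,n)}{n^{\frac1R}(\log n)^{1+\delta}}\xrightarrow{a.s.}0.$$
   Context: Discrete model. Let $Z_1,Z_2,\dots$ be i.i.d. with law $\mathbf p$. The random trees $\mathcal T_n=\mathcal T_n(\mathbf p)$, $n\ge1$, are rooted at $v_0$, with edges directed from children to parents. $\mathcal T_1$ has vertices $v_0,v_1$ and a directed edge from $v_1$ to $v_0$. Given $\mathcal T_n$ with vertex set $\{v_0,\dots,v_n\}$, a new vertex $v_{n+1}$ selects a vertex $V_n$ uniformly at random from $\{v_0,\dots,v_n\}$ and attaches (by a directed edge from $v_{n+1}$) to the vertex at distance $\min(Z_{n+1},\mathrm{dist}(v_0,V_n))$ from $V_n$ on the path from $V_n$ to $v_0$. Here $V_n$ and $Z_{n+1}$ are independent of each other and $Z_{n+1}$ is independent of the past. Constants. $f(s)=\sum_{k\ge0}p_ks^k$, $s\ge0$. $s_0$ is the unique positive root of $sf'(s)=f(s)$ if it exists, and otherwise the radius of convergence of $f$. $R:=\lim_{s\uparrow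 s_0}s/f(s)$. *)

theory Defs
  imports "HOL-Probability.Probability"
begin

text \<open>A tree with root \<open>0\<close> is given by its set of edges, each directed from child to parent, so that
  \<open>E ^^ m\<close> relates a vertex to its ancestor \<open>m\<close> generations up, and the directed path
  from \<open>u\<close> to \<open>0\<close> is the path from \<open>u\<close> to the root.\<close>

definition root_dist :: "nat rel \<Rightarrow> nat \<Rightarrow> nat" where
  "root_dist E u = (LEAST d. (u, 0) \<in> E ^^ d)"

definition ancestor :: "nat rel \<Rightarrow> nat \<Rightarrow> nat \<Rightarrow> nat" where
  "ancestor E u m = (THE w. (u, w) \<in> E ^^ m)"

text \<open>The edges of the tree on the vertices \<open>{0..n}\<close> for given realizations \<open>z\<close> of the step lengths and
  \<open>v\<close> of the uniformly selected vertices; \<open>v n\<close> and \<open>z (n + 1)\<close> determine the parent of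
  vertex \<open>n + 1\<close>. The model starts at \<open>n = 1\<close>; the value at \<open>0\<close> is the isolated root.\<close>

fun tree_edges :: "(nat \<Rightarrow> nat) \<Rightarrow> (nat \<Rightarrow> nat) \<Rightarrow> nat \<Rightarrow> nat rel" where
  "tree_edges z v 0 = {}"
| "tree_edges z v (Suc 0) = {(1, 0)}"
| "tree_edges z v (Suc (Suc n)) =
     (let E = tree_edges z v (Suc n); u = v (Suc n)
      in insert (Suc (Suc n), ancestor E u (min (z (Suc (Suc n))) (root_dist E u))) E)"

definition vertex_degree :: "nat rel \<Rightarrow> nat \<Rightarrow> nat" where
  "vertex_degree E u = card {e \<in> E. fst e = u \<or> snd e = u}"

locale random_tree_model = prob_space M for M :: "'a measure" +
  fixes p :: "nat pmf" and Z V :: "nat \<Rightarrow> 'a \<Rightarrow> nat"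
  assumes indep: "indep_vars (\<lambda>_. count_space UNIV) (case_sum Z V) ({1..} <+> {1..})"
    and law_Z: "n \<ge> 1 \<Longrightarrow> distr M (count_space UNIV) (Z n) = measure_pmf p"
    and law_V: "n \<ge> 1 \<Longrightarrow> distr M (count_space UNIV) (V n) = measure_pmf (pmf_of_set {0..n})"

definition gen_fun :: "nat pmf \<Rightarrow> real \<Rightarrow> real" where
  "gen_fun p s = (\<Sum>k. pmf p k * s ^ k)"

text \<open>Roots are sought strictly inside the disc of convergence, where \<open>gen_fun p\<close> is
  differentiable. A root at the boundary (with the one-sided derivative) would equal the radius of
  convergence, which is the value assigned by the \<open>else\<close> branch anyway.\<close>

definition is_root :: "nat pmf \<Rightarrow> real \<Rightarrow> bool" where
  "is_root p s \<longleftrightarrow> s > 0 \<and> ereal s < conv_radius (pmf p) \<and> s * deriv (gen_fun p) s = gen_fun p s"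

definition s0 :: "nat pmf \<Rightarrow> ereal" where
  "s0 p = (if \<exists>!s. is_root p s then ereal (THE s. is_root p s) else conv_radius (pmf p))"

text \<open>The left limit is taken in the extended reals only because \<open>s0 p\<close> has that type; for finite
  \<open>s0 p\<close> it is the usual left limit over the reals.\<close>

definition R_const :: "nat pmf \<Rightarrow> real" where
  "R_const p = Lim (at_left (s0 p)) (\<lambda>s. real_of_ereal s / gen_fun p (real_of_ereal s))"

end

theory Submission
  imports Defs "HOL-Real_Asymp.Real_Asymp"
begin

text \<open>Fix the vertex \<open>k \<ge> 1\<close> and record only the generation of each vertex in the subtree of \<open>k\<close>. A new
vertex that selects a vertex of generation \<open>l\<close> and draws the step length \<open>a\<close> becomes a member of
generation \<open>l + 1 - a\<close> if \<open>a \<le> l\<close>, and lies outside the subtree otherwise. Because \<open>k\<close> is not the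
root, truncating the step at the root never matters inside the subtree, so the generations form an urn with
infinitely many colours, and the degree of \<open>k\<close> is one more than the number of vertices of generation
\<open>1\<close> (\<open>vertex_degree_eq\<close>).

For a weight \<open>h\<close> on generations, let \<open>pop k h n\<close> be the sum of \<open>h\<close> over the members of the subtree at
time \<open>n\<close>. Its expected increment, given the past, is \<open>pop k (reprod p h) n / (n + 1)\<close> with the
reproduction operator \<open>reprod p h l = (\<Sum>a\<le>l. p a * h (l + 1 - a))\<close>, the transition operator of a random walk
with steps \<open>1 - Z\<close> that is killed on going below generation \<open>1\<close>. Hence an inequality between
\<open>reprod p h\<close> and \<open>\<kappa> * h\<close> gives polynomial growth with exponent \<open>\<kappa>\<close>, and the exponent of the theorem is
the exponential growth rate of this operator. That rate is \<open>1 / R\<close>, the minimum of \<open>f s / s\<close>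
(\<open>R_const_props\<close>), and both inequalities come from exponential weights:

\<^item> \<open>h l = s powr (- l)\<close> with \<open>s\<close> the minimizer satisfies \<open>reprod p h \<le> h / R\<close>
  (\<open>supereigenvector\<close>). So the mean of \<open>pop\<close> is at most \<open>n powr (1 / R)\<close>. The Markov inequality and the
  Borel-Cantelli lemma along \<open>n = 2 ^ r\<close> cost a factor \<open>r powr (1 + \<epsilon>)\<close>, which is a power of
  \<open>ln n\<close>, and monotonicity in \<open>n\<close> fills the gaps between powers of two.

\<^item> For \<open>\<kappa> < 1 / R\<close> there is a finitely supported \<open>h\<close> with \<open>reprod p h \<ge> \<kappa> * h\<close>
  (\<open>subeigenvector\<close>): truncate the step law, tilt it exponentially so that the step \<open>1 - Z\<close> has mean zero, and
  take a wide tent function. Once \<open>pop\<close> exceeds a large constant, the mean of \<open>1 / pop\<close> decays like a power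
  of \<open>n\<close> with exponent close to \<open>\<kappa>\<close>, so \<open>pop\<close> almost surely grows at least like that power
  (\<open>lower_dyadic\<close>). The constant is exceeded eventually because \<open>k\<close> itself produces children at rate
  \<open>p 0 / (n + 1)\<close>, and these rates have a divergent sum (\<open>children_unbounded\<close>).

The lower bound concerns the total weight, hence some generation \<open>j\<close> in a finite range. It passes to
generation \<open>1\<close> because a generation of size \<open>x\<close> at time \<open>2 ^ r\<close> adds a number of order \<open>x\<close> to every
generation into which it reproduces by time \<open>2 ^ (r + 1)\<close>, up to a probability exponentially small in \<open>x\<close>
(\<open>transfer\<close>). Every generation leads to generation \<open>1\<close>, since \<open>p 0 > 0\<close> allows steps up by one and
some \<open>p d > 0\<close> with \<open>d \<ge> 2\<close> allows steps down by \<open>d - 1\<close> (\<open>feeds_all\<close>).\<close>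

section \<open>Generations below a fixed vertex\<close>

text \<open>A vertex of generation \<open>0\<close> is the fixed vertex itself, and \<open>None\<close> stands for a vertex outside its
subtree.\<close>

definition child_gen :: "nat option \<Rightarrow> nat \<Rightarrow> nat option" where
  "child_gen g a = (case g of None \<Rightarrow> None | Some l \<Rightarrow> if a \<le> l then Some (Suc (l - a)) else None)"

text \<open>The guard \<open>v (i - 1) \<ge> i\<close> makes the recursion well-founded for arbitrary \<open>v\<close>. Selected vertices
satisfy \<open>v (i - 1) < i\<close>, so their generations do not depend on the default value.\<close>

function gen :: "nat \<Rightarrow> (nat \<Rightarrow> nat) \<Rightarrow> (nat \<Rightarrow> nat) \<Rightarrow> nat \<Rightarrow> nat option" where
  "gen k z v i = (if i < k then None else if i = k then Some 0 else if v (i - 1) \<ge> i then None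
     else child_gen (gen k z v (v (i - 1))) (z i))"
  by auto
termination by (relation "Wellfounded.measure (\<lambda>(k, z, v, i). i)") auto
declare gen.simps[simp del]

text \<open>The parent of \<open>i\<close> depends only on the tree before \<open>i\<close> arrives, so a single function describes
the trees at all times.\<close>

definition parent :: "(nat \<Rightarrow> nat) \<Rightarrow> (nat \<Rightarrow> nat) \<Rightarrow> nat \<Rightarrow> nat" where
  "parent z v i = (if i = 1 then 0 else
     let E = tree_edges z v (i - 1); u = v (i - 1) in ancestor E u (min (z i) (root_dist E u)))"

lemma tree_edges_eq: "tree_edges z v n = (\<lambda>i. (i, parent z v i)) ` {1..n}"
proof (induction n rule: tree_edges.induct[where P="\<lambda>z v n. tree_edges z v n = (\<lambda>i. (i, parent z v i)) ` {1..n}"])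
  case (3 z v n)
  have "{1..Suc (Suc n)} = insert (Suc (Suc n)) {1..Suc n}" by auto
  then show ?case using 3 by (simp add: Let_def parent_def)
qed (auto simp: parent_def)

text \<open>Used to join the path from a selected vertex to its ancestor with the path from that ancestor on.\<close>

lemma all_less_shift:
  fixes m n :: nat
  assumes "\<And>j. j < m \<Longrightarrow> P j"
  shows "(\<forall>j<n. P (j + m)) \<longleftrightarrow> (\<forall>j<n + m. P j)"
  using assms by (metis add_less_cancel_right le_add_diff_inverse2 not_le)

text \<open>In a finite functional graph whose arrows decrease, walks are the iterates of the function that have not
stopped at \<open>0\<close> before, and every step lowers the vertex by at least one.\<close>

lemma relpow_graph:
  fixes q :: "nat \<Rightarrow> nat"
  assumes q: "\<forall>i\<in>{1..n}. q i < i" and E: "E = (\<lambda>i. (i, q i)) ` {1..n}" and u: "u \<le> n"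
  shows "(u, w) \<in> E ^^ m \<longleftrightarrow> (q ^^ m) u = w \<and> (\<forall>i<m. (q ^^ i) u \<ge> 1)"
    and "(\<forall>i<m. (q ^^ i) u \<ge> 1) \<Longrightarrow> (q ^^ m) u + m \<le> u"
proof (induction m arbitrary: w)
  case (Suc m)
  { case 2
    then have *: "\<forall>i<m. (q ^^ i) u \<ge> 1" "(q ^^ m) u \<ge> 1" by auto
    with Suc.IH(2) have "(q ^^ m) u + m \<le> u" by blast
    then show ?case using q[rule_format, of "(q ^^ m) u"] u * by auto }
  note two = this
  { case 1
    have "(u, w) \<in> E ^^ Suc m \<longleftrightarrow> (\<exists>x. (u, x) \<in> E ^^ m \<and> (x, w) \<in> E)" by auto
    also have "\<dots> \<longleftrightarrow> (\<forall>i<m. (q ^^ i) u \<ge> 1) \<and> ((q ^^ m) u, w) \<in> E" using Suc.IH(1) by auto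
    also have "\<dots> \<longleftrightarrow> (q ^^ Suc m) u = w \<and> (\<forall>i<Suc m. (q ^^ i) u \<ge> 1)"
    proof -
      have "(q ^^ m) u \<le> n" if "\<forall>i<m. (q ^^ i) u \<ge> 1" using Suc.IH(2)[OF that] u by simp
      then show ?thesis unfolding E by (auto simp: less_Suc_eq)
    qed
    finally show ?case . }
qed (use u in auto)

lemma root_dist_graph:
  fixes q :: "nat \<Rightarrow> nat"
  assumes q: "\<forall>i\<in>{1..n}. q i < i" and E: "E = (\<lambda>i. (i, q i)) ` {1..n}" and u: "u \<le> n"
  shows "(u, 0) \<in> E ^^ root_dist E u"
proof -
  have "\<exists>d. (u, 0) \<in> E ^^ d" using u
  proof (induction u rule: less_induct)
    case (less u)
    show ?case
    proof (cases "u = 0")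
      case True then show ?thesis by (intro exI[of _ 0]) auto
    next
      case False
      then have "q u < u" using q less.prems by simp
      then obtain d where "(q u, 0) \<in> E ^^ d" using less by fastforce
      moreover have "(u, q u) \<in> E" using False less.prems unfolding E by auto
      ultimately show ?thesis by (intro exI[of _ "Suc d"]) (meson relpow_Suc_I2)
    qed
  qed
  then show ?thesis unfolding root_dist_def by (rule LeastI_ex)
qed

lemma parent_eq:
  assumes "\<forall>i\<in>{1..n}. parent z v i < i" "v n \<le> n" "n \<ge> 1"
  shows "parent z v (Suc n) = (parent z v ^^ min (z (Suc n)) (root_dist (tree_edges z v n) (v n))) (v n)"
    and "\<And>i. i < root_dist (tree_edges z v n) (v n) \<Longrightarrow> (parent z v ^^ i) (v n) \<ge> 1"
    and "(parent z v ^^ root_dist (tree_edges z v n) (v n)) (v n) = 0"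
proof -
  let ?E = "tree_edges z v n" let ?d = "root_dist ?E (v n)"
  note g = relpow_graph[OF assms(1) tree_edges_eq assms(2)]
  have d: "(v n, 0) \<in> ?E ^^ ?d" by (rule root_dist_graph[OF assms(1) tree_edges_eq assms(2)])
  then show "(parent z v ^^ ?d) (v n) = 0" using g(1) by blast
  show pos: "(parent z v ^^ i) (v n) \<ge> 1" if "i < ?d" for i using d that g(1) by blast
  have "ancestor ?E (v n) m = (parent z v ^^ m) (v n)" if "m \<le> ?d" for m
  proof -
    have "(v n, w) \<in> ?E ^^ m \<longleftrightarrow> (parent z v ^^ m) (v n) = w" for w
      using g(1)[of w m] pos that by (meson less_le_trans)
    then show ?thesis unfolding ancestor_def by auto
  qed
  then show "parent z v (Suc n) = (parent z v ^^ min (z (Suc n)) ?d) (v n)"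
    using assms(3) by (simp add: parent_def Let_def)
qed

lemma parent_less:
  assumes v: "\<And>i. 1 \<le> i \<Longrightarrow> v i \<le> i" and "1 \<le> i"
  shows "parent z v i < i"
  using assms(2)
proof (induction i rule: less_induct)
  case (less i)
  show ?case
  proof (cases "i = 1")
    case False
    then obtain n where i: "i = Suc n" "n \<ge> 1" using less.prems by (cases i) auto
    have p: "\<forall>j\<in>{1..n}. parent z v j < j" using less.IH i by auto
    note e = parent_eq[where z=z and v=v and n=n, OF p v[OF i(2)] i(2)]
    let ?m = "min (z (Suc n)) (root_dist (tree_edges z v n) (v n))"
    have "(parent z v ^^ ?m) (v n) + ?m \<le> v n"
      by (rule relpow_graph(2)[OF p refl v[OF i(2)]]) (use e(2) in auto)
    then show ?thesis using e(1) v[OF i(2)] i by simp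
  qed (simp add: parent_def)
qed

text \<open>The generation of a vertex is its distance to \<open>k\<close>. The induction compares the step length with the
distance \<open>l\<close> from the selected vertex \<open>u\<close> to \<open>k\<close>. If it is at most \<open>l\<close>, it is
less than the distance from \<open>u\<close> to the root, because \<open>k\<close> is not the root, and the new parent still lies
below or at \<open>k\<close>. If it is larger, the new parent is a proper ancestor of \<open>k\<close>, and the new vertex is
outside the subtree.\<close>

lemma gen_iff:
  assumes v: "\<And>i. 1 \<le> i \<Longrightarrow> v i \<le> i" and k: "k \<ge> 1"
  shows "gen k z v i = Some l \<longleftrightarrow> (parent z v ^^ l) i = k \<and> (\<forall>j<l. (parent z v ^^ j) i \<ge> 1)"
proof (induction i arbitrary: l rule: less_induct)
  case (less i)
  let ?q = "parent z v"
  have q: "?q i < i" if "1 \<le> i" for i by (rule parent_less[OF v that])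
  have q': "\<forall>j\<in>{1..n}. ?q j < j" for n using q by simp
  have desc: "(?q ^^ m) u + m \<le> u" if "\<forall>j<m. (?q ^^ j) u \<ge> 1" for u m
    by (rule relpow_graph(2)[OF q' refl order.refl that])
  consider "i < k" | "i = k" | "i > k" by linarith
  then show ?case
  proof cases
    case 1
    then have "gen k z v i = None" by (subst gen.simps) simp
    then show ?thesis using desc[of l i] 1 by (metis add_leE leD option.distinct(1))
  next
    case 2
    then have "gen k z v i = Some 0" by (subst gen.simps) simp
    then show ?thesis using desc[of l i] 2 by auto
  next
    case 3
    then obtain n where i: "i = Suc n" "n \<ge> 1" "n \<ge> k" using k by (cases i) auto
    let ?u = "v n" let ?d = "root_dist (tree_edges z v n) ?u" let ?a = "z i"
    have u: "?u \<le> n" "?u < i" using v[OF i(2)] i(1) by auto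
    have g: "gen k z v i = child_gen (gen k z v ?u) ?a"
      using u i by (subst gen.simps) simp
    note e = parent_eq[where z=z and v=v and n=n, OF q' u(1) i(2), folded i(1)]
    let ?m = "min ?a ?d"
    note IH = less.IH[OF u(2)]
    \<comment> \<open>the vertex \<open>k\<close> is met strictly before the root\<close>
    have lek: "j < ?d" if "(?q ^^ j) ?u = k" "\<forall>j'<j. (?q ^^ j') ?u \<ge> 1" for j
    proof (rule ccontr)
      assume "\<not> j < ?d"
      then have "?d \<le> j" by simp
      then consider "?d = j" | "?d < j" by linarith
      then show False using that e(3) k by cases auto
    qed
    have R: "((?q ^^ l) i = k \<and> (\<forall>j<l. (?q ^^ j) i \<ge> 1)) \<longleftrightarrow>
       (\<exists>l'. l = Suc l' \<and> (?q ^^ (l' + ?m)) ?u = k \<and> (\<forall>j<l'. (?q ^^ (j + ?m)) ?u \<ge> 1))"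
    proof (cases l)
      case 0 then show ?thesis using 3 by simp
    next
      case (Suc l')
      have s: "(?q ^^ Suc j) i = (?q ^^ (j + ?m)) ?u" for j
        unfolding funpow_Suc_right o_def e(1) by (simp add: funpow_add)
      have "(\<forall>j<Suc l'. (?q ^^ j) i \<ge> 1) \<longleftrightarrow> (\<forall>j<l'. (?q ^^ Suc j) i \<ge> 1)"
        using i(1) by (subst All_less_Suc2) simp
      then show ?thesis unfolding Suc s by simp
    qed
    have full: "(\<forall>j<l'. (?q ^^ (j + ?m)) ?u \<ge> 1) \<longleftrightarrow> (\<forall>j<l' + ?m. (?q ^^ j) ?u \<ge> 1)" for l'
      by (rule all_less_shift) (use e(2) in simp)
    have "((?q ^^ l) i = k \<and> (\<forall>j<l. (?q ^^ j) i \<ge> 1)) \<longleftrightarrow> (\<exists>l'. l = Suc l' \<and> gen k z v ?u = Some (l' + ?m))"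
      unfolding R full IH ..
    also have "\<dots> \<longleftrightarrow> (\<exists>l'. l = Suc l' \<and> gen k z v ?u = Some (l' + ?a))"
    proof -
      have "?m = ?a" if "gen k z v ?u = Some (l' + ?m)" for l'
        using lek[of "l' + ?m"] that unfolding IH by fastforce
      moreover have "?m = ?a" if "gen k z v ?u = Some (l' + ?a)" for l'
        using lek[of "l' + ?a"] that unfolding IH by fastforce
      ultimately show ?thesis by metis
    qed
    also have "\<dots> \<longleftrightarrow> gen k z v i = Some l"
      unfolding g child_gen_def by (auto split: option.splits)
    finally show ?thesis by simp
  qed
qed

text \<open>The edges at \<open>k\<close> are the one to its parent and one for each child, that is, for each vertex of
generation \<open>1\<close>.\<close>

lemma vertex_degree_eq:
  assumes v: "\<And>i. 1 \<le> i \<Longrightarrow> v i \<le> i" and k: "k \<ge> 1" and n: "n \<ge> k"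
  shows "vertex_degree (tree_edges z v n) k = Suc (card {i\<in>{..n}. gen k z v i = Some 1})"
proof -
  let ?q = "parent z v" let ?A = "{i\<in>{..n}. gen k z v i = Some 1}"
  have q: "?q i < i" if "1 \<le> i" for i by (rule parent_less[OF v that])
  have A: "?A = {i\<in>{1..n}. ?q i = k}"
    using gen_iff[OF v k, of z _ 1] by auto
  have "{e \<in> tree_edges z v n. fst e = k \<or> snd e = k} = (\<lambda>i. (i, ?q i)) ` (insert k ?A)"
    unfolding A tree_edges_eq using k n by auto
  moreover have "k \<notin> ?A" unfolding A using q[OF k] by auto
  moreover have "card ((\<lambda>i. (i, ?q i)) ` (insert k ?A)) = card (insert k ?A)"
    by (rule card_image) (simp add: inj_on_def)
  ultimately show ?thesis unfolding vertex_degree_def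
    using card_insert_disjoint[of ?A k] by simp
qed

lemma gen_cong:
  assumes "k \<ge> 1" "\<And>j. 1 \<le> j \<Longrightarrow> j \<le> i \<Longrightarrow> z j = z' j" "\<And>j. 1 \<le> j \<Longrightarrow> j < i \<Longrightarrow> v j = v' j"
  shows "gen k z v i = gen k z' v' i"
  using assms(2,3)
proof (induction i rule: less_induct)
  case (less i)
  show ?case
  proof (cases "i \<le> k")
    case True
    then show ?thesis by (subst (1 2) gen.simps) auto
  next
    case False
    then have e: "v' (i - 1) = v (i - 1)" "z' i = z i" using less.prems assms(1) by simp_all
    show ?thesis
    proof (cases "v (i - 1) \<ge> i")
      case True then show ?thesis using e by (subst (1 2) gen.simps) simp
    next
      case F: False
      have "gen k z v (v (i - 1)) = gen k z' v' (v (i - 1))"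
        using F less.prems by (intro less.IH) auto
      then show ?thesis using e by (subst (1 2) gen.simps) simp
    qed
  qed
qed

lemma gen_upd: "k \<ge> 1 \<Longrightarrow> i \<le> n \<Longrightarrow> gen k (z(Suc n := a)) (v(n := b)) i = gen k z v i"
  by (rule gen_cong) auto

lemma gen_new:
  assumes "k \<ge> 1" "k \<le> n" "b \<le> n"
  shows "gen k (z(Suc n := a)) (v(n := b)) (Suc n) = child_gen (gen k z v b) a"
  using assms by (subst gen.simps) (simp add: gen_upd)

section \<open>Functionals of the past\<close>

text \<open>The tree at time \<open>n\<close> is a function of the step lengths with indices up to \<open>n\<close> and of the
selected vertices with indices below \<open>n\<close>. The step to time \<open>n + 1\<close> uses \<open>v n\<close> and
\<open>z (n + 1)\<close>.\<close>

definition adapted :: "nat \<Rightarrow> ((nat \<Rightarrow> nat) \<Rightarrow> (nat \<Rightarrow> nat) \<Rightarrow> 'b) \<Rightarrow> bool" where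
  "adapted n F \<longleftrightarrow> (\<forall>z z' v v'. (\<forall>i\<in>{1..n}. z i = z' i) \<longrightarrow> (\<forall>i\<in>{1..<n}. v i = v' i) \<longrightarrow> F z v = F z' v')"

lemma adaptedD:
  assumes "adapted n F" "\<And>i. 1 \<le> i \<Longrightarrow> i \<le> n \<Longrightarrow> z i = z' i" "\<And>i. 1 \<le> i \<Longrightarrow> i < n \<Longrightarrow> v i = v' i"
  shows "F z v = F z' v'"
  using assms unfolding adapted_def by simp

lemma adaptedI:
  assumes "\<And>z z' v v'. (\<And>i. 1 \<le> i \<Longrightarrow> i \<le> n \<Longrightarrow> z i = z' i) \<Longrightarrow> (\<And>i. 1 \<le> i \<Longrightarrow> i < n \<Longrightarrow> v i = v' i) \<Longrightarrow> F z v = F z' v'"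
  shows "adapted n F"
  unfolding adapted_def by (intro allI impI, rule assms) auto

lemma adapted_mono: 
  assumes "adapted m F" "m \<le> n" shows "adapted n F"
  by (rule adaptedI, rule adaptedD[OF assms(1)]) (use assms(2) in auto)

lemma adapted_upd:
  assumes "adapted n F" shows "F (z(Suc n := a)) (v(n := b)) = F z v"
  by (rule adaptedD[OF assms]) auto

lemma adapted_comb1:
  assumes "adapted n F" shows "adapted n (\<lambda>z v. H (F z v))"
  by (rule adaptedI, rule arg_cong[where f=H], rule adaptedD[OF assms]) auto

lemma adapted_comb2:
  assumes "adapted n F" "adapted n G" shows "adapted n (\<lambda>z v. H (F z v) (G z v))"
  by (rule adaptedI, rule arg_cong2[where f=H], rule adaptedD[OF assms(1)], auto, rule adaptedD[OF assms(2)], auto)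

section \<open>Weighted populations\<close>

definition weight :: "(nat \<Rightarrow> real) \<Rightarrow> nat option \<Rightarrow> real" where
  "weight h g = (case g of None \<Rightarrow> 0 | Some l \<Rightarrow> h l)"

definition pop :: "nat \<Rightarrow> (nat \<Rightarrow> real) \<Rightarrow> nat \<Rightarrow> (nat \<Rightarrow> nat) \<Rightarrow> (nat \<Rightarrow> nat) \<Rightarrow> real" where
  "pop k h n z v = (\<Sum>i\<le>n. weight h (gen k z v i))"

text \<open>Mean total weight of the new member when a vertex of generation \<open>l\<close> is selected, by summing over the
step length. Larger step lengths leave the subtree.\<close>

definition reprod :: "nat pmf \<Rightarrow> (nat \<Rightarrow> real) \<Rightarrow> nat \<Rightarrow> real" where
  "reprod p h l = (\<Sum>a\<le>l. pmf p a * h (Suc (l - a)))"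

lemma weight_simps[simp]: "weight h None = 0" "weight h (Some l) = h l"
  by (simp_all add: weight_def)

lemma weight_mono: "(\<And>l. h l \<le> h' l) \<Longrightarrow> weight h g \<le> weight h' g"
  by (cases g) auto

lemma weight_nonneg: "(\<And>l. 0 \<le> h l) \<Longrightarrow> 0 \<le> weight h g"
  by (cases g) auto

lemma weight_cmult: "weight (\<lambda>l. c * h l) g = c * weight h g"
  by (cases g) auto

lemma pop_nonneg: "(\<And>l. 0 \<le> h l) \<Longrightarrow> 0 \<le> pop k h n z v"
  unfolding pop_def by (intro sum_nonneg weight_nonneg)

lemma pop_weight_mono: "(\<And>l. h l \<le> h' l) \<Longrightarrow> pop k h n z v \<le> pop k h' n z v"
  unfolding pop_def by (intro sum_mono weight_mono)

lemma pop_cmult: "pop k (\<lambda>l. c * h l) n z v = c * pop k h n z v"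
  unfolding pop_def weight_cmult sum_distrib_left ..

lemma pop_mono: "(\<And>l. 0 \<le> h l) \<Longrightarrow> m \<le> n \<Longrightarrow> pop k h m z v \<le> pop k h n z v"
  unfolding pop_def by (intro sum_mono2) (auto intro: weight_nonneg)

lemma adapted_pop: "k \<ge> 1 \<Longrightarrow> adapted n (pop k h n)"
  unfolding pop_def
  by (rule adaptedI, rule sum.cong[OF refl], rule arg_cong[where f="weight h"], rule gen_cong) auto

lemma pop_step:
  assumes "k \<ge> 1" "k \<le> n" "b \<le> n"
  shows "pop k h (Suc n) (z(Suc n := a)) (v(n := b)) = pop k h n z v + weight h (child_gen (gen k z v b) a)"
  unfolding pop_def using assms by (simp add: gen_new gen_upd)

text \<open>The weight for which \<open>pop\<close> counts the members of generation \<open>j\<close>.\<close>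

definition gen_ind :: "nat \<Rightarrow> nat \<Rightarrow> real" where
  "gen_ind j l = (if l = j then 1 else 0)"

lemma gen_ind_nonneg[simp]: "0 \<le> gen_ind j l" by (simp add: gen_ind_def)

text \<open>When \<open>k\<close> arrives it is the only member of its subtree.\<close>

lemma pop_start:
  assumes "k \<ge> 1" shows "pop k h k z v = h 0"
proof -
  have "weight h (gen k z v i) = (if i = k then h 0 else 0)" if "i \<le> k" for i
    using that by (subst gen.simps) auto
  then show ?thesis unfolding pop_def by simp
qed

lemma pop_self: "k \<ge> 1 \<Longrightarrow> k \<le> n \<Longrightarrow> 1 \<le> pop k (gen_ind 0) n z v"
  using pop_mono[of "gen_ind 0" k n k z v] pop_start[of k "gen_ind 0" z v] by (simp add: gen_ind_def)

text \<open>The moments below are taken on an event of an earlier time \<open>m\<close>, which turns a bound at time \<open>m\<close> into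
a bound at all later times by monotonicity.\<close>

lemma adapted_guard:
  assumes "k \<ge> 1" "adapted m P" "m \<le> n"
  shows "adapted n (\<lambda>z v. if P z v then \<phi> (pop k h n z v) else 0)"
  by (rule adapted_comb2[OF adapted_mono[OF assms(2,3)] adapted_pop[OF assms(1)], of "\<lambda>q w. if q then \<phi> w else 0"])

lemma adapted_le_pop: "k \<ge> 1 \<Longrightarrow> adapted n (\<lambda>z v. x \<le> pop k h n z v)"
  by (rule adapted_comb1[OF adapted_pop])

section \<open>One step of the process\<close>

abbreviation uniform_upto :: "nat \<Rightarrow> nat pmf" where "uniform_upto n \<equiv> pmf_of_set {0..n}"

context random_tree_model
begin

abbreviation (input) ZZ :: "'a \<Rightarrow> nat \<Rightarrow> nat" where "ZZ \<omega> \<equiv> \<lambda>i. Z i \<omega>"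

abbreviation (input) VV :: "'a \<Rightarrow> nat \<Rightarrow> nat" where "VV \<omega> \<equiv> \<lambda>i. V i \<omega>"

abbreviation step_law :: "nat \<Rightarrow> (nat \<times> nat) pmf" where "step_law n \<equiv> pair_pmf (uniform_upto n) p"

definition past :: "nat \<Rightarrow> (nat + nat) set" where
  "past n = Inl ` {1..n} \<union> Inr ` {1..<n}"

lemma finite_past: "finite (past n)" by (simp add: past_def)

lemma rv_Z: "i \<ge> 1 \<Longrightarrow> Z i \<in> measurable M (count_space UNIV)"
  and rv_V: "i \<ge> 1 \<Longrightarrow> V i \<in> measurable M (count_space UNIV)"
  using indep unfolding indep_vars_def by force+

definition new_idx :: "nat \<Rightarrow> (nat + nat) set" where
  "new_idx n = {Inl (Suc n), Inr n}"

text \<open>Both blocks of indices are finite and the variables are discrete, so the product measurable spaces are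
discrete. Hence every function of a block is measurable.\<close>

lemma indep_past:
  assumes "n \<ge> 1"
  shows "indep_var (count_space (PiE (past n) (\<lambda>_. UNIV))) (\<lambda>\<omega>. restrict (\<lambda>i. case_sum Z V i \<omega>) (past n))
     (count_space (PiE (new_idx n) (\<lambda>_. UNIV))) (\<lambda>\<omega>. restrict (\<lambda>i. case_sum Z V i \<omega>) (new_idx n))"
proof -
  have i: "indep_var (PiM (past n) (\<lambda>_. count_space UNIV)) (\<lambda>\<omega>. restrict (\<lambda>i. case_sum Z V i \<omega>) (past n))
     (PiM (new_idx n) (\<lambda>_. count_space UNIV)) (\<lambda>\<omega>. restrict (\<lambda>i. case_sum Z V i \<omega>) (new_idx n))"
    by (rule indep_var_restrict[OF indep]) (use assms in \<open>auto simp: past_def new_idx_def\<close>)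
  have e: "PiM (past n) (\<lambda>_. count_space (UNIV :: nat set)) = count_space (PiE (past n) (\<lambda>_. UNIV))"
    "PiM (new_idx n) (\<lambda>_. count_space (UNIV :: nat set)) = count_space (PiE (new_idx n) (\<lambda>_. UNIV))"
    by (intro count_space_PiM_finite; simp add: finite_past new_idx_def)+
  show ?thesis using i unfolding e .
qed

lemma law_step: assumes "n \<ge> 1"
  shows "distr M (count_space UNIV) (\<lambda>\<omega>. (V n \<omega>, Z (Suc n) \<omega>)) = measure_pmf (step_law n)"
proof -
  have i: "indep_var (PiM {Inr n} (\<lambda>_. count_space UNIV)) (\<lambda>\<omega>. restrict (\<lambda>i. case_sum Z V i \<omega>) {Inr n})
     (PiM {Inl (Suc n)} (\<lambda>_. count_space UNIV)) (\<lambda>\<omega>. restrict (\<lambda>i. case_sum Z V i \<omega>) {Inl (Suc n)})"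
    by (rule indep_var_restrict[OF indep]) (use assms in auto)
  have "indep_var (count_space UNIV) ((\<lambda>x. x (Inr n)) \<circ> (\<lambda>\<omega>. restrict (\<lambda>i. case_sum Z V i \<omega>) {Inr n}))
     (count_space UNIV) ((\<lambda>x. x (Inl (Suc n))) \<circ> (\<lambda>\<omega>. restrict (\<lambda>i. case_sum Z V i \<omega>) {Inl (Suc n)}))"
    by (rule indep_var_compose[OF i]) auto
  then have iv: "indep_var (count_space UNIV) (V n) (count_space UNIV) (Z (Suc n))" by (simp add: o_def)
  then have d: "distr M (count_space UNIV \<Otimes>\<^sub>M count_space UNIV) (\<lambda>\<omega>. (V n \<omega>, Z (Suc n) \<omega>))
    = measure_pmf (uniform_upto n) \<Otimes>\<^sub>M measure_pmf p"
    unfolding indep_var_distribution_eq using assms by (simp add: law_V law_Z)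
  have "distr M (count_space UNIV) (\<lambda>\<omega>. (V n \<omega>, Z (Suc n) \<omega>)) = 
     distr M (count_space UNIV \<Otimes>\<^sub>M count_space UNIV) (\<lambda>\<omega>. (V n \<omega>, Z (Suc n) \<omega>))"
    by (simp add: pair_measure_countable)
  also have "\<dots> = measure_pmf (step_law n)"
  proof (rule measure_eqI_countable[where A=UNIV])
    fix a :: "nat \<times> nat"
    show "emeasure (distr M (count_space UNIV \<Otimes>\<^sub>M count_space UNIV) (\<lambda>\<omega>. (V n \<omega>, Z (Suc n) \<omega>))) {a}
      = emeasure (measure_pmf (step_law n)) {a}"
    proof (cases a)
      case (Pair b c)
      have "emeasure (measure_pmf (uniform_upto n) \<Otimes>\<^sub>M measure_pmf p) ({b} \<times> {c}) = emeasure (uniform_upto n) {b} * emeasure p {c}"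
        by (rule measure_pmf.emeasure_pair_measure_Times) auto
      then show ?thesis unfolding d Pair
        by (simp add: emeasure_pmf_single pmf_pair ennreal_mult del: pmf_of_set)
    qed
  qed (auto simp: pair_measure_countable)
  finally show ?thesis .
qed

text \<open>A functional of two sequences, read as a functional of one family indexed by the disjoint sum.\<close>

definition hist_fun :: "((nat \<Rightarrow> nat) \<Rightarrow> (nat \<Rightarrow> nat) \<Rightarrow> 'c) \<Rightarrow> (nat + nat \<Rightarrow> nat) \<Rightarrow> 'c" where
  "hist_fun F x = F (\<lambda>i. x (Inl i)) (\<lambda>i. x (Inr i))"

lemma hist_fun_past:
  assumes "adapted n F"
  shows "F (ZZ \<omega>) (VV \<omega>) = hist_fun F (restrict (\<lambda>i. case_sum Z V i \<omega>) (past n))"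
  unfolding hist_fun_def by (rule adaptedD[OF assms]) (auto simp: past_def)

lemma measurable_past: "(\<lambda>\<omega>. restrict (\<lambda>i. case_sum Z V i \<omega>) (past n)) \<in> measurable M (count_space (PiE (past n) (\<lambda>_. UNIV)))"
proof -
  have "(\<lambda>\<omega>. restrict (\<lambda>i. case_sum Z V i \<omega>) (past n)) \<in> measurable M (PiM (past n) (\<lambda>_. count_space UNIV))"
    by (intro measurable_restrict) (auto simp: past_def rv_Z rv_V)
  then show ?thesis by (subst (asm) count_space_PiM_finite) (auto simp: finite_past)
qed

lemma measurable_adapted:
  assumes "adapted n F" "F \<in> UNIV \<rightarrow> UNIV \<rightarrow> space N"
  shows "(\<lambda>\<omega>. F (ZZ \<omega>) (VV \<omega>)) \<in> measurable M N"
proof -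
  have "(\<lambda>\<omega>. hist_fun F (restrict (\<lambda>i. case_sum Z V i \<omega>) (past n))) \<in> measurable M N"
    by (rule measurable_compose[OF measurable_past]) (use assms in \<open>auto simp: hist_fun_def\<close>)
  then show ?thesis using hist_fun_past[OF assms(1)] by (simp cong: measurable_cong)
qed

text \<open>The Markov property in the form that the proof needs: integrate out the step to time \<open>n + 1\<close>, which is
independent of the past and has law \<open>step_law n\<close>.\<close>

lemma nn_integral_step:
  fixes F :: "(nat \<Rightarrow> nat) \<Rightarrow> (nat \<Rightarrow> nat) \<Rightarrow> ennreal"
  assumes "adapted (Suc n) F" "n \<ge> 1"
  shows "(\<integral>\<^sup>+\<omega>. F (ZZ \<omega>) (VV \<omega>) \<partial>M) =
    (\<integral>\<^sup>+\<omega>. (\<integral>\<^sup>+y. F ((ZZ \<omega>)(Suc n := snd y)) ((VV \<omega>)(n := fst y)) \<partial>step_law n) \<partial>M)"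
proof -
  let ?X = "\<lambda>\<omega>. restrict (\<lambda>i. case_sum Z V i \<omega>) (past n)"
  let ?Y = "\<lambda>\<omega>. restrict (\<lambda>i. case_sum Z V i \<omega>) (new_idx n)"
  let ?P = "count_space (PiE (past n) (\<lambda>_. UNIV :: nat set))"
  let ?Q = "count_space (PiE (new_idx n) (\<lambda>_. UNIV :: nat set))"
  let ?\<pi> = "\<lambda>y :: nat + nat \<Rightarrow> nat. (y (Inr n), y (Inl (Suc n)))"
  define G where "G = (\<lambda>y z v. F (z(Suc n := snd y)) (v(n := fst y)) :: ennreal)"
  have adG: "adapted n (G y)" for y
    unfolding adapted_def G_def
    by (intro allI impI adaptedD[OF assms(1)]) auto
  have cP: "countable (PiE (past n) (\<lambda>_. UNIV :: nat set))" "countable (PiE (new_idx n) (\<lambda>_. UNIV :: nat set))"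
    by (intro countable_PiE; auto simp: finite_past new_idx_def)+
  have eqP: "?P \<Otimes>\<^sub>M ?Q = count_space (PiE (past n) (\<lambda>_. UNIV :: nat set) \<times> PiE (new_idx n) (\<lambda>_. UNIV :: nat set))"
    by (intro pair_measure_countable cP)
  have m1: "?X \<in> measurable M ?P" and m2: "?Y \<in> measurable M ?Q"
    using indep_past[OF assms(2)] unfolding indep_var_distribution_eq by simp_all
  have \<pi>: "?\<pi> (?Y \<omega>) = (V n \<omega>, Z (Suc n) \<omega>)" for \<omega> by (simp add: new_idx_def)
  have "F (ZZ \<omega>) (VV \<omega>) = (case (?X \<omega>, ?Y \<omega>) of (x, y) \<Rightarrow> hist_fun (G (?\<pi> y)) x)" for \<omega>
    unfolding prod.case hist_fun_past[OF adG, symmetric] \<pi> unfolding G_def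
    by (auto intro!: arg_cong2[where f=F])
  then have "(\<integral>\<^sup>+\<omega>. F (ZZ \<omega>) (VV \<omega>) \<partial>M) =
     (\<integral>\<^sup>+\<omega>. (case (?X \<omega>, ?Y \<omega>) of (x, y) \<Rightarrow> hist_fun (G (?\<pi> y)) x) \<partial>M)" by simp
  also have "\<dots> = (\<integral>\<^sup>+u. (case u of (x, y) \<Rightarrow> hist_fun (G (?\<pi> y)) x) \<partial>distr M (?P \<Otimes>\<^sub>M ?Q) (\<lambda>\<omega>. (?X \<omega>, ?Y \<omega>)))"
    by (rule nn_integral_distr[symmetric], rule measurable_Pair[OF m1 m2]) (simp add: eqP)
  also have "\<dots> = (\<integral>\<^sup>+u. (case u of (x, y) \<Rightarrow> hist_fun (G (?\<pi> y)) x) \<partial>(distr M ?P ?X \<Otimes>\<^sub>M distr M ?Q ?Y))"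
    using indep_past[OF assms(2)] unfolding indep_var_distribution_eq by simp
  also have "\<dots> = (\<integral>\<^sup>+x. (\<integral>\<^sup>+y. hist_fun (G (?\<pi> y)) x \<partial>distr M ?Q ?Y) \<partial>distr M ?P ?X)"
  proof -
    interpret Y: prob_space "distr M ?Q ?Y" by (rule prob_space_distr[OF m2])
    have "sets (distr M ?P ?X \<Otimes>\<^sub>M distr M ?Q ?Y) = sets (?P \<Otimes>\<^sub>M ?Q)"
      by (intro sets_pair_measure_cong) auto
    then have "(\<lambda>u. (case u of (x, y) \<Rightarrow> hist_fun (G (?\<pi> y)) x)) \<in> borel_measurable (distr M ?P ?X \<Otimes>\<^sub>M distr M ?Q ?Y)"
      by (subst measurable_cong_sets[OF _ refl, of _ "?P \<Otimes>\<^sub>M ?Q"]) (auto simp: eqP)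
    from Y.nn_integral_fst[OF this] show ?thesis by simp
  qed
  also have "\<dots> = (\<integral>\<^sup>+\<omega>. (\<integral>\<^sup>+y. hist_fun (G (?\<pi> y)) (?X \<omega>) \<partial>distr M ?Q ?Y) \<partial>M)"
    by (rule nn_integral_distr[OF m1]) simp
  also have "\<dots> = (\<integral>\<^sup>+\<omega>. (\<integral>\<^sup>+y. G y (ZZ \<omega>) (VV \<omega>) \<partial>step_law n) \<partial>M)"
  proof (intro nn_integral_cong)
    fix \<omega>
    have mVZ: "(\<lambda>\<omega>. (V n \<omega>, Z (Suc n) \<omega>)) \<in> measurable M (count_space UNIV)"
      using measurable_compose[OF m2, of ?\<pi> "count_space UNIV"] unfolding \<pi> by simp
    have "(\<integral>\<^sup>+y. hist_fun (G (?\<pi> y)) (?X \<omega>) \<partial>distr M ?Q ?Y) = (\<integral>\<^sup>+\<omega>'. hist_fun (G (?\<pi> (?Y \<omega>'))) (?X \<omega>) \<partial>M)"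
      by (rule nn_integral_distr[OF m2]) simp
    also have "\<dots> = (\<integral>\<^sup>+\<omega>'. G (V n \<omega>', Z (Suc n) \<omega>') (ZZ \<omega>) (VV \<omega>) \<partial>M)"
      unfolding \<pi> hist_fun_past[OF adG, symmetric] ..
    also have "\<dots> = (\<integral>\<^sup>+y. G y (ZZ \<omega>) (VV \<omega>) \<partial>distr M (count_space UNIV) (\<lambda>\<omega>. (V n \<omega>, Z (Suc n) \<omega>)))"
      by (rule nn_integral_distr[OF mVZ, symmetric]) simp
    finally show "(\<integral>\<^sup>+y. hist_fun (G (?\<pi> y)) (?X \<omega>) \<partial>distr M ?Q ?Y) = (\<integral>\<^sup>+y. G y (ZZ \<omega>) (VV \<omega>) \<partial>step_law n)"
      unfolding law_step[OF assms(2)] .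
  qed
  finally show ?thesis by (simp add: G_def)
qed

text \<open>The increment vanishes outside the finite set of pairs \<open>(b, a)\<close> where \<open>a\<close> is at most the
generation of \<open>b\<close>, which makes it bounded and reduces its mean to a finite sum.\<close>

lemma increment_mean:
  fixes h :: "nat \<Rightarrow> real" and g :: "nat \<Rightarrow> nat option"
  shows "integrable (step_law n) (\<lambda>y. weight h (child_gen (g (fst y)) (snd y)))" (is "integrable _ ?f")
    and "(\<integral>y. weight h (child_gen (g (fst y)) (snd y)) \<partial>step_law n) = (\<Sum>b\<le>n. weight (reprod p h) (g b)) / real (Suc n)"
proof -
  define L where "L = (\<lambda>b. case g b of None \<Rightarrow> {} | Some l \<Rightarrow> {..l})"
  define A where "A = (SIGMA b:{..n}. L b)"
  have finL: "finite (L b)" for b by (simp add: L_def split: option.split)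
  then have fin: "finite A" unfolding A_def by (intro finite_SigmaI) auto
  have supp: "y \<in> A" if "y \<in> set_pmf (step_law n)" "?f y \<noteq> 0" for y
    using that by (auto simp: A_def L_def child_gen_def split: option.splits if_splits)
  have "finite (insert 0 (?f ` A))" using fin by simp
  then obtain C where C: "\<forall>x\<in>insert 0 (?f ` A). norm x \<le> C"
    using finite_imp_bounded bounded_iff by metis
  show "integrable (step_law n) ?f"
    by (rule measure_pmf.integrable_const_bound[where B=C]) (use supp C in \<open>force simp: AE_measure_pmf_iff\<close>, simp)
  have "(\<integral>y. ?f y \<partial>step_law n) = (\<Sum>y\<in>A. ?f y * pmf (step_law n) y)"
    by (rule integral_measure_pmf_real[OF fin]) (use supp in auto)
  also have "\<dots> = (\<Sum>(b, a)\<in>A. weight h (child_gen (g b) a) * (pmf p a / real (Suc n)))"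
    by (intro sum.cong refl) (auto simp: A_def pmf_pair)
  also have "\<dots> = (\<Sum>b\<le>n. \<Sum>a\<in>L b. weight h (child_gen (g b) a) * (pmf p a / real (Suc n)))"
    unfolding A_def by (rule sum.Sigma[symmetric]) (use finL in auto)
  also have "\<dots> = (\<Sum>b\<le>n. weight (reprod p h) (g b) / real (Suc n))"
    by (intro sum.cong refl)
      (auto simp: L_def child_gen_def reprod_def sum_divide_distrib mult.commute split: option.split)
  finally show "(\<integral>y. ?f y \<partial>step_law n) = (\<Sum>b\<le>n. weight (reprod p h) (g b)) / real (Suc n)"
    by (simp only: sum_divide_distrib)
qed

text \<open>An affine bound for a function of the increment is all that is used, since only the mean of the increment
is known exactly.\<close>

lemma step_bound:
  fixes h :: "nat \<Rightarrow> real"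
  assumes k: "k \<ge> 1" "k \<le> n"
    and f: "\<And>a b. b \<le> n \<Longrightarrow> 0 \<le> f (b, a)"
    "\<And>a b. b \<le> n \<Longrightarrow> f (b, a) \<le> A + B * weight h (child_gen (gen k z v b) a)"
  shows "(\<integral>\<^sup>+y. ennreal (f y) \<partial>step_law n) \<le> ennreal (A + B * (pop k (reprod p h) n z v / real (Suc n)))"
proof -
  let ?D = "\<lambda>y. weight h (child_gen (gen k z v (fst y)) (snd y))"
  have "(\<integral>\<^sup>+y. ennreal (f y) \<partial>step_law n) \<le> (\<integral>\<^sup>+y. ennreal (A + B * ?D y) \<partial>step_law n)"
    by (intro nn_integral_mono_AE) (use f in \<open>auto simp: AE_measure_pmf_iff intro!: ennreal_leI\<close>)
  also have "\<dots> = ennreal (\<integral>y. A + B * ?D y \<partial>step_law n)"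
  proof (rule nn_integral_eq_integral)
    show "integrable (step_law n) (\<lambda>y. A + B * ?D y)"
      by (intro Bochner_Integration.integrable_add integrable_mult_right increment_mean) simp
    show "AE y in step_law n. 0 \<le> A + B * ?D y"
      using order_trans[OF f] by (auto simp: AE_measure_pmf_iff)
  qed
  also have "(\<integral>y. A + B * ?D y \<partial>step_law n) = A + B * (\<integral>y. ?D y \<partial>step_law n)"
    using increment_mean(1)[where g="gen k z v"] by simp
  finally show ?thesis unfolding increment_mean(2) pop_def .
qed

section \<open>Moments of weighted populations\<close>

text \<open>The common source of all moment estimates. Premise \<open>A\<close> replaces \<open>\<phi>\<close> by a chord over the
possible increments, premise \<open>B\<close> says that the resulting mean change is at most \<open>\<gamma> / (n + 1)\<close> times
\<open>\<phi>\<close>. A step then multiplies the moment by at most \<open>1 + \<gamma> / (n + 1) \<le> exp (\<gamma> / (n + 1))\<close>. The sign of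
\<open>\<gamma>\<close> is arbitrary: it is positive for the growth of the mean and negative for the decay of reciprocal and
exponential moments.\<close>

lemma moment_bound:
  fixes h :: "nat \<Rightarrow> real" and \<phi> \<beta> :: "real \<Rightarrow> real" and P :: "(nat \<Rightarrow> nat) \<Rightarrow> (nat \<Rightarrow> nat) \<Rightarrow> bool"
  assumes k: "k \<ge> 1" "k \<le> m" and P: "adapted m P" and h: "\<And>l. 0 \<le> h l"
    and \<phi>: "\<And>w. 0 \<le> w \<Longrightarrow> 0 \<le> \<phi> w"
    and A: "\<And>n z v x. m \<le> n \<Longrightarrow> P z v \<Longrightarrow> x = 0 \<or> x \<in> range h \<Longrightarrow>
      \<phi> (pop k h n z v + x) \<le> \<phi> (pop k h n z v) + \<beta> (pop k h n z v) * x"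
    and B: "\<And>n z v. m \<le> n \<Longrightarrow> P z v \<Longrightarrow>
      \<beta> (pop k h n z v) * pop k (reprod p h) n z v \<le> \<gamma> * \<phi> (pop k h n z v)"
    and "m \<le> N"
  shows "(\<integral>\<^sup>+\<omega>. ennreal (if P (ZZ \<omega>) (VV \<omega>) then \<phi> (pop k h N (ZZ \<omega>) (VV \<omega>)) else 0) \<partial>M) \<le>
     ennreal (exp (\<gamma> * (\<Sum>i\<in>{m..<N}. 1 / real (Suc i)))) *
     (\<integral>\<^sup>+\<omega>. ennreal (if P (ZZ \<omega>) (VV \<omega>) then \<phi> (pop k h m (ZZ \<omega>) (VV \<omega>)) else 0) \<partial>M)"
  using \<open>m \<le> N\<close>
proof (induction N rule: dec_induct)
  case base
  show ?case by simp
next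
  case (step n)
  let ?F = "\<lambda>n z v. ennreal (if P z v then \<phi> (pop k h n z v) else 0)"
  let ?c = "exp (\<gamma> / real (Suc n))"
  have ad: "adapted n (?F n)"
    if "m \<le> n" for n
    by (rule adapted_comb2[OF adapted_mono[OF P that] adapted_pop[OF k(1)], of "\<lambda>q w. ennreal (if q then \<phi> w else 0)"])
  have n: "n \<ge> 1" "k \<le> n" using k step.hyps by auto
  have "(\<integral>\<^sup>+\<omega>. ?F (Suc n) (ZZ \<omega>) (VV \<omega>) \<partial>M) = (\<integral>\<^sup>+\<omega>. (\<integral>\<^sup>+y. ?F (Suc n) ((ZZ \<omega>)(Suc n := snd y)) ((VV \<omega>)(n := fst y)) \<partial>step_law n) \<partial>M)"
    using step.hyps n by (intro nn_integral_step ad) auto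
  also have "\<dots> \<le> (\<integral>\<^sup>+\<omega>. ennreal ?c * ?F n (ZZ \<omega>) (VV \<omega>) \<partial>M)"
  proof (rule nn_integral_mono)
    fix \<omega>
    let ?z = "ZZ \<omega>" let ?v = "VV \<omega>" let ?w = "pop k h n ?z ?v"
    have PP: "P (?z(Suc n := a)) (?v(n := b)) = P ?z ?v" for a b
      by (rule adapted_upd[OF adapted_mono[OF P]]) (use step.hyps in auto)
    show "(\<integral>\<^sup>+y. ?F (Suc n) (?z(Suc n := snd y)) (?v(n := fst y)) \<partial>step_law n) \<le> ennreal ?c * ?F n ?z ?v"
    proof (cases "P ?z ?v")
      case False then show ?thesis by (simp add: PP)
    next
      case True
      have w: "?w \<ge> 0" by (rule pop_nonneg[OF h])
      have inc: "weight h (child_gen (gen k ?z ?v b) a) = 0 \<or> weight h (child_gen (gen k ?z ?v b) a) \<in> range h" for a b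
        by (cases "child_gen (gen k ?z ?v b) a") auto
      have "(\<integral>\<^sup>+y. ennreal (\<phi> (pop k h (Suc n) (?z(Suc n := snd y)) (?v(n := fst y)))) \<partial>step_law n)
        \<le> ennreal (\<phi> ?w + \<beta> ?w * (pop k (reprod p h) n ?z ?v / real (Suc n)))"
      proof (rule step_bound[OF k(1) n(2)])
        fix a b assume b: "b \<le> n"
        show "0 \<le> \<phi> (pop k h (Suc n) (?z(Suc n := snd (b, a))) (?v(n := fst (b, a))))"
          by (intro \<phi> pop_nonneg h)
        show "\<phi> (pop k h (Suc n) (?z(Suc n := snd (b, a))) (?v(n := fst (b, a))))
           \<le> \<phi> ?w + \<beta> ?w * weight h (child_gen (gen k ?z ?v b) a)"
          unfolding fst_conv snd_conv pop_step[OF k(1) n(2) b]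
          using A[OF _ True inc] step.hyps by simp
      qed
      also have "\<dots> \<le> ennreal (?c * \<phi> ?w)"
      proof (rule ennreal_leI)
        have "\<beta> ?w * pop k (reprod p h) n ?z ?v / real (Suc n) \<le> \<gamma> * \<phi> ?w / real (Suc n)"
          using B[OF _ True] step.hyps by (intro divide_right_mono) auto
        then have "\<phi> ?w + \<beta> ?w * (pop k (reprod p h) n ?z ?v / real (Suc n)) \<le> (1 + \<gamma> / real (Suc n)) * \<phi> ?w"
          by (simp add: algebra_simps)
        also have "\<dots> \<le> ?c * \<phi> ?w" by (intro mult_right_mono exp_ge_add_one_self \<phi> w)
        finally show "\<phi> ?w + \<beta> ?w * (pop k (reprod p h) n ?z ?v / real (Suc n)) \<le> ?c * \<phi> ?w" .
      qed
      finally show ?thesis using True by (simp add: PP ennreal_mult' )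
    qed
  qed
  also have "\<dots> = ennreal ?c * (\<integral>\<^sup>+\<omega>. ?F n (ZZ \<omega>) (VV \<omega>) \<partial>M)"
    by (intro nn_integral_cmult measurable_adapted[OF ad]) (use step.hyps in auto)
  also have "\<dots> \<le> ennreal ?c * (ennreal (exp (\<gamma> * (\<Sum>i\<in>{m..<n}. 1 / real (Suc i)))) * (\<integral>\<^sup>+\<omega>. ?F m (ZZ \<omega>) (VV \<omega>) \<partial>M))"
    by (intro mult_left_mono step.IH) auto
  also have "\<dots> = ennreal (exp (\<gamma> * (\<Sum>i\<in>{m..<Suc n}. 1 / real (Suc i)))) * (\<integral>\<^sup>+\<omega>. ?F m (ZZ \<omega>) (VV \<omega>) \<partial>M)"
  proof -
    have "(\<Sum>i\<in>{m..<Suc n}. 1 / real (Suc i)) = (\<Sum>i\<in>{m..<n}. 1 / real (Suc i)) + 1 / real (Suc n)"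
      using step.hyps by simp
    then show ?thesis
      by (simp add: mult.assoc[symmetric] ennreal_mult[symmetric] exp_add[symmetric] algebra_simps del: of_nat_Suc)
  qed
  finally show ?case .
qed

end

lemma harmonic_lower:
  assumes "m \<le> N" shows "ln ((real N + 1) / (real m + 1)) \<le> (\<Sum>i\<in>{m..<N}. 1 / real (Suc i))"
  using assms
proof (induction N rule: dec_induct)
  case (step n)
  have "ln ((real (Suc n) + 1) / (real m + 1)) = ln ((real n + 1) / (real m + 1)) + ln (1 + 1 / real (Suc n))"
  proof (subst ln_mult_pos[symmetric])
    have "(real (Suc n) + 1) / (real m + 1) = (real n + 1) * ((real n + 2) / (real n + 1)) / (real m + 1)" by simp
    also have "(real n + 2) / (real n + 1) = 1 + 1 / real (Suc n)" by (simp add: field_simps)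
    finally show "ln ((real (Suc n) + 1) / (real m + 1)) = ln ((real n + 1) / (real m + 1) * (1 + 1 / real (Suc n)))"
      by simp
  qed (auto intro: add_pos_nonneg)
  also have "ln (1 + 1 / real (Suc n)) \<le> 1 / real (Suc n)" by (rule ln_add_one_self_le_self) simp
  finally show ?case using step by simp
qed simp

lemma harmonic_upper:
  assumes "1 \<le> m" "m \<le> N" shows "(\<Sum>i\<in>{m..<N}. 1 / real (Suc i)) \<le> ln (real N / real m)"
  using assms(2)
proof (induction N rule: dec_induct)
  case (step n)
  have n: "n \<ge> 1" using assms step by simp
  have "ln (real n / real m) = ln (real (Suc n) / real m) + ln (1 - 1 / real (Suc n))"
  proof (subst ln_mult_pos[symmetric])
    have "real n / real m = real (Suc n) * (real n / real (Suc n)) / real m" by simp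
    also have "real n / real (Suc n) = 1 - 1 / real (Suc n)" by (simp add: divide_simps)
    finally show "ln (real n / real m) = ln (real (Suc n) / real m * (1 - 1 / real (Suc n)))"
      by (simp only: times_divide_eq_left)
  qed (use n assms in auto)
  moreover have "ln (1 + (- (1 / real (Suc n)))) \<le> - (1 / real (Suc n))"
    using n by (intro ln_add_one_self_le_self2) (auto simp: field_simps)
  ultimately show ?case using step by simp
qed (use assms in simp)

section \<open>The constant R as a minimum\<close>

lemma continuous_on_power_series:
  fixes c :: "nat \<Rightarrow> real"
  assumes "summable (\<lambda>k. \<bar>c k\<bar> * s ^ k)"
  shows "continuous_on {0..s} (\<lambda>x. \<Sum>k. c k * x ^ k)"
proof (rule uniform_limit_theorem)
  show "uniform_limit {0..s} (\<lambda>n x. \<Sum>k<n. c k * x ^ k) (\<lambda>x. \<Sum>k. c k * x ^ k) sequentially"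
    by (rule Weierstrass_m_test[OF _ assms]) (auto simp: abs_mult intro!: mult_left_mono power_mono)
  show "\<forall>\<^sub>F n in sequentially. continuous_on {0..s} (\<lambda>x. \<Sum>k<n. c k * x ^ k)"
    by (intro always_eventually allI continuous_intros)
qed simp

abbreviation psum :: "nat pmf \<Rightarrow> nat \<Rightarrow> real \<Rightarrow> real" where
  "psum p N s \<equiv> (\<Sum>k\<le>N. pmf p k * s ^ k)"

text \<open>The step law has an atom at \<open>0\<close> and one at some \<open>d \<ge> 2\<close>, so the walk with steps \<open>1 - Z\<close>
moves in both directions.\<close>

locale offspring =
  fixes p :: "nat pmf" and d :: nat
  assumes p0: "0 < pmf p 0" and d: "d \<ge> 2" "0 < pmf p d"
begin

text \<open>This is \<open>s * f' s - f s\<close>, whose zero defines \<open>s0\<close>. It is \<open>s\<^sup>2\<close> times the derivative of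
\<open>f s / s\<close>.\<close>

definition psi :: "real \<Rightarrow> real" where
  "psi s = (\<Sum>k. (real k - 1) * pmf p k * s ^ k)"

lemma conv_radius_ge_1: "conv_radius (pmf p) \<ge> 1"
proof -
  have "summable (\<lambda>k. pmf p k * 1 ^ k)"
  proof (rule summableI_nonneg_bounded)
    show "(\<Sum>k<n. pmf p k * 1 ^ k) \<le> 1" for n
      using measure_measure_pmf_finite[of "{..<n}" p] measure_pmf.prob_le_1[of p "{..<n}"] by simp
  qed simp
  from conv_radius_geI[OF this] show ?thesis by (simp add: one_ereal_def)
qed

lemma summable_gen_fun: "0 \<le> s \<Longrightarrow> ereal s < conv_radius (pmf p) \<Longrightarrow> summable (\<lambda>k. pmf p k * s ^ k)"
  by (rule summable_in_conv_radius) simp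

lemma psum_le: "summable (\<lambda>k. pmf p k * s ^ k) \<Longrightarrow> 0 \<le> s \<Longrightarrow> psum p N s \<le> gen_fun p s"
  unfolding gen_fun_def by (rule sum_le_suminf) auto

lemma gen_fun_pos: "summable (\<lambda>k. pmf p k * s ^ k) \<Longrightarrow> 0 \<le> s \<Longrightarrow> 0 < gen_fun p s"
  using psum_le[of s 0] p0 by simp

lemma psi_eq:
  assumes "0 \<le> s" "ereal s < conv_radius (pmf p)"
  shows "summable (\<lambda>k. (real k - 1) * pmf p k * s ^ k)"
    and "s * deriv (gen_fun p) s - gen_fun p s = psi s"
proof -
  obtain t where t: "ereal s < ereal t" "ereal t < conv_radius (pmf p)"
    using assms(2) ereal_dense2 by blast
  have st: "summable (\<lambda>k. pmf p k * t ^ k)" using t assms by (intro summable_gen_fun) auto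
  have lt: "norm s < norm t" using t assms by simp
  have D: "(gen_fun p has_field_derivative (\<Sum>k. diffs (pmf p) k * s ^ k)) (at s)"
    unfolding gen_fun_def[abs_def] by (rule termdiffs_strong[OF st lt])
  have sd: "summable (\<lambda>k. diffs (pmf p) k * s ^ k)"
    by (rule termdiff_converges[OF lt]) (use t assms in \<open>auto intro!: summable_in_conv_radius elim: le_less_trans[rotated]\<close>)
  have "(\<lambda>k. s * (real k * pmf p k * s ^ (k - Suc 0))) sums (s * (\<Sum>k. diffs (pmf p) k * s ^ k))"
    by (intro sums_mult diffs_equiv sd)
  moreover have "s * (real k * pmf p k * s ^ (k - Suc 0)) = real k * pmf p k * s ^ k" for k
    by (cases k) auto
  ultimately have "(\<lambda>k. real k * pmf p k * s ^ k) sums (s * deriv (gen_fun p) s)"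
    using DERIV_imp_deriv[OF D] by simp
  moreover have "(\<lambda>k. pmf p k * s ^ k) sums gen_fun p s"
    unfolding gen_fun_def using summable_gen_fun[OF assms] by (rule summable_sums)
  ultimately have "(\<lambda>k. real k * pmf p k * s ^ k - pmf p k * s ^ k) sums (s * deriv (gen_fun p) s - gen_fun p s)"
    by (rule sums_diff)
  then have "(\<lambda>k. (real k - 1) * pmf p k * s ^ k) sums (s * deriv (gen_fun p) s - gen_fun p s)"
    by (simp add: algebra_simps)
  then show "summable (\<lambda>k. (real k - 1) * pmf p k * s ^ k)"
    and "s * deriv (gen_fun p) s - gen_fun p s = psi s"
    unfolding psi_def by (auto simp: sums_iff)
qed

lemma is_root_iff: "is_root p s \<longleftrightarrow> s > 0 \<and> ereal s < conv_radius (pmf p) \<and> psi s = 0"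
  unfolding is_root_def using psi_eq(2)[of s] by force

text \<open>Only the term of index \<open>0\<close> is negative.\<close>

lemma psi_lower:
  assumes "0 \<le> s" "ereal s < conv_radius (pmf p)" 
  shows "psi s \<ge> - pmf p 0 + (real d - 1) * pmf p d * s ^ d"
proof -
  let ?g = "\<lambda>k. (real k - 1) * pmf p k * s ^ k"
  have "(\<Sum>k\<in>{0, d}. ?g k) \<le> psi s"
    unfolding psi_def
  proof (rule sum_le_suminf[OF psi_eq(1)[OF assms]])
    show "0 \<le> ?g k" if "k \<in> - {0, d}" for k using that assms by (cases k) auto
  qed simp
  then show ?thesis using d by simp
qed

lemma psi_strict_mono:
  assumes "0 \<le> s" "s < t" "ereal t < conv_radius (pmf p)" 
  shows "psi s < psi t"
proof -
  let ?g = "\<lambda>k. (real k - 1) * pmf p k * t ^ k - (real k - 1) * pmf p k * s ^ k"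
  have s: "ereal s < conv_radius (pmf p)" using assms by (metis ereal_less_eq(3) le_less_trans less_imp_le)
  have S: "summable (\<lambda>k. (real k - 1) * pmf p k * s ^ k)" "summable (\<lambda>k. (real k - 1) * pmf p k * t ^ k)"
    using assms s by (auto intro!: psi_eq(1))
  have "0 < suminf ?g"
  proof (rule suminf_pos2[where i=d])
    show "summable ?g" by (rule summable_diff[OF S(2,1)])
    show "0 \<le> ?g k" for k
      using assms power_mono[of s t k]
      by (cases k) (auto intro!: mult_left_mono)
    show "0 < ?g d" using d assms power_strict_mono[of s t d] by simp
  qed
  then show ?thesis unfolding psi_def using suminf_diff[OF S(2,1)] by simp
qed

lemma continuous_psi:
  assumes "0 \<le> s" "ereal s < conv_radius (pmf p)" 
  shows "continuous_on {0..s} psi"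
  unfolding psi_def
proof (rule continuous_on_power_series)
  have "summable (\<lambda>k. (real k - 1) * pmf p k * s ^ k + (if k = 0 then 2 * pmf p 0 else 0))"
    by (intro summable_add psi_eq(1) assms) (simp add: summable_If_finite)
  moreover have "(real k - 1) * pmf p k * s ^ k + (if k = 0 then 2 * pmf p 0 else 0) = \<bar>(real k - 1) * pmf p k\<bar> * s ^ k" for k
    by (cases k) (auto simp: abs_mult)
  ultimately show "summable (\<lambda>k. \<bar>(real k - 1) * pmf p k\<bar> * s ^ k)" by simp
qed

text \<open>The function \<open>f s / s\<close> is convex in \<open>ln s\<close>, so it lies above its tangent at \<open>r\<close>. The premise
only bounds the partial sums at \<open>s\<close>, which allows \<open>s\<close> on the circle of convergence. Termwise this is
\<open>exp y \<ge> 1 + y\<close> with \<open>y = (k - 1) * ln (s / r)\<close>.\<close>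

lemma tangent:
  assumes r: "0 < r" "ereal r < conv_radius (pmf p)" and s: "0 < s" "\<And>N. psum p N s \<le> \<mu> * s"
  shows "gen_fun p r + ln (s / r) * psi r \<le> \<mu> * r"
proof -
  have "(\<lambda>N. \<Sum>k\<le>N. pmf p k * r ^ k + ln (s / r) * ((real k - 1) * pmf p k * r ^ k))
     \<longlonglongrightarrow> gen_fun p r + ln (s / r) * psi r"
  proof -
    have "(\<lambda>k. pmf p k * r ^ k) sums gen_fun p r" "(\<lambda>k. (real k - 1) * pmf p k * r ^ k) sums psi r"
      unfolding gen_fun_def psi_def using r by (auto intro!: summable_sums summable_gen_fun psi_eq(1))
    then show ?thesis using sums_add sums_mult sums_def_le by blast
  qed
  then show ?thesis
  proof (rule LIMSEQ_le_const2, intro exI[of _ 0] allI impI)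
    fix N
    have "pmf p k * r ^ k + ln (s / r) * ((real k - 1) * pmf p k * r ^ k) \<le> (r / s) * (pmf p k * s ^ k)" for k
    proof -
      have "1 + (real k - 1) * ln (s / r) \<le> exp ((real k - 1) * ln (s / r))" by (rule exp_ge_add_one_self)
      also have "\<dots> = (s / r) powr (real k - 1)" using r s by (simp add: powr_def)
      also have "\<dots> = (s / r) ^ k * (r / s)" using r s by (simp add: powr_diff powr_realpow)
      finally have "pmf p k * r ^ k * (1 + (real k - 1) * ln (s / r)) \<le> pmf p k * r ^ k * ((s / r) ^ k * (r / s))"
        using r by (intro mult_left_mono) auto
      also have "\<dots> = (r / s) * (pmf p k * s ^ k)" using r s by (simp add: power_divide)
      finally show ?thesis by (simp add: algebra_simps)
    qed
    then have "(\<Sum>k\<le>N. pmf p k * r ^ k + ln (s / r) * ((real k - 1) * pmf p k * r ^ k)) \<le> (r / s) * psum p N s"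
      unfolding sum_distrib_left by (intro sum_mono)
    also have "\<dots> \<le> (r / s) * (\<mu> * s)" using r s by (intro mult_left_mono) auto
    finally show "(\<Sum>k\<le>N. pmf p k * r ^ k + ln (s / r) * ((real k - 1) * pmf p k * r ^ k)) \<le> \<mu> * r"
      using s by (simp add: mult.commute)
  qed
qed

lemma psum_mono: "0 \<le> s \<Longrightarrow> M \<le> N \<Longrightarrow> psum p M s \<le> psum p N s"
  by (intro sum_mono2) auto

text \<open>If a root exists, the tangent there is horizontal and the root minimizes \<open>f s / s\<close>. Otherwise \<open>psi\<close>
is negative up to the radius of convergence \<open>r\<close>. Then \<open>r\<close> is finite, as \<open>psi\<close> would become
nonnegative eventually. Moreover \<open>f s / s\<close> decreases on the whole interval, so \<open>f\<close> stays bounded, the series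
converges at \<open>r\<close>, and the minimum is attained there.\<close>

lemma s0_minimizer:
  "\<exists>r>0. s0 p = ereal r \<and> summable (\<lambda>k. pmf p k * r ^ k) \<and>
     (\<forall>s \<mu>. 0 < s \<longrightarrow> (\<forall>N. psum p N s \<le> \<mu> * s) \<longrightarrow> gen_fun p r \<le> \<mu> * r)"
proof (cases "\<exists>r. is_root p r")
  case True
  then obtain r where r: "is_root p r" by blast
  have u: "r' = r" if "is_root p r'" for r'
    using that r psi_strict_mono[of r r'] psi_strict_mono[of r' r] unfolding is_root_iff by (cases r r' rule: linorder_cases) auto
  then have "s0 p = ereal r" unfolding s0_def using r by (metis the_equality)
  moreover have "r > 0" "summable (\<lambda>k. pmf p k * r ^ k)" "ereal r < conv_radius (pmf p)" "psi r = 0"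
    using r unfolding is_root_iff by (auto intro: summable_gen_fun)
  ultimately show ?thesis using tangent[of r] by (intro exI[of _ r]) auto
next
  case False
  then have s0: "s0 p = conv_radius (pmf p)" unfolding s0_def by auto
  have neg: "psi s < 0" if s: "0 < s" "ereal s < conv_radius (pmf p)" for s
  proof (rule ccontr)
    assume "\<not> psi s < 0"
    moreover have "psi 0 < 0" unfolding psi_def using p0 powser_zero[of "\<lambda>k. (real k - 1) * pmf p k"] by simp
    ultimately obtain x where x: "0 \<le> x" "x \<le> s" "psi x = 0"
      using IVT'[of psi 0 0 s] continuous_psi[of s] s by auto
    moreover have "x \<noteq> 0" using x \<open>psi 0 < 0\<close> by auto
    moreover have "ereal x < conv_radius (pmf p)" using x s by (metis ereal_less_eq(3) le_less_trans)
    ultimately show False using False unfolding is_root_iff by auto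
  qed
  have "conv_radius (pmf p) \<noteq> \<infinity>"
  proof
    assume inf: "conv_radius (pmf p) = \<infinity>"
    define s where "s = max 1 (pmf p 0 / pmf p d)"
    have s: "s \<ge> 1" "pmf p 0 \<le> pmf p d * s" using d unfolding s_def by (auto simp: field_simps max_def)
    have "pmf p d * s \<le> (real d - 1) * pmf p d * s ^ d"
      using d s self_le_power[of s d] mult_mono[of "pmf p d" "(real d - 1) * pmf p d" s "s ^ d"] by auto
    then have "psi s \<ge> 0" using psi_lower[of s] s inf by auto
    then show False using neg[of s] s inf by auto
  qed
  then obtain r where r: "conv_radius (pmf p) = ereal r" "r \<ge> 1"
    using conv_radius_ge_1 by (cases "conv_radius (pmf p)") auto
  have dec: "gen_fun p t \<le> \<mu> * t" if "0 < s" "s \<le> t" "t < r" "\<And>N. psum p N s \<le> \<mu> * s" for s t \<mu>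
  proof -
    have "gen_fun p t + ln (s / t) * psi t \<le> \<mu> * t" by (rule tangent) (use that r in auto)
    moreover have "0 \<le> ln (s / t) * psi t"
      using that r neg[of t] by (intro mult_nonpos_nonpos) (auto simp: field_simps)
    ultimately show ?thesis by simp
  qed
  have sm: "summable (\<lambda>k. pmf p k * r ^ k)"
  proof (rule summableI_nonneg_bounded)
    \<comment> \<open>the value of \<open>f s / s\<close> at \<open>r / 2\<close>, a bound for it on the rest of the interval\<close>
    define C where "C = gen_fun p (r / 2) / (r / 2)"
    have sr: "summable (\<lambda>k. pmf p k * (r / 2) ^ k)" using r by (intro summable_gen_fun) auto
    have le: "psum p N t \<le> C * t" if "r / 2 \<le> t" "t < r" for t N
    proof -
      have "psum p N t \<le> gen_fun p t" using that r by (intro psum_le summable_gen_fun) auto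
      also have "\<dots> \<le> C * t"
        using that r psum_le[OF sr] by (intro dec[of "r / 2"]) (auto simp: C_def)
      finally show ?thesis .
    qed
    show "(\<Sum>k<N. pmf p k * r ^ k) \<le> C * r" for N
    proof -
      have "psum p N r \<le> C * r"
      proof (rule tendsto_le)
        show "((\<lambda>t. psum p N t) \<longlongrightarrow> psum p N r) (at_left r)"
          by (intro tendsto_intros)
        show "((\<lambda>t. C * t) \<longlongrightarrow> C * r) (at_left r)" by (intro tendsto_intros)
        show "\<forall>\<^sub>F t in at_left r. psum p N t \<le> C * t"
          using r le by (auto simp: eventually_at_left_field intro!: exI[of _ "r / 2"])
      qed simp
      moreover have "(\<Sum>k<N. pmf p k * r ^ k) \<le> psum p N r"
        using r by (intro sum_mono2) auto
      ultimately show ?thesis by simp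
    qed
  qed (use r in auto)
  moreover have "gen_fun p r \<le> \<mu> * r" if s: "0 < s" "\<forall>N. psum p N s \<le> \<mu> * s" for s \<mu>
  proof -
    have "summable (\<lambda>k. pmf p k * s ^ k)"
    proof (rule summableI_nonneg_bounded)
      show "(\<Sum>k<N. pmf p k * s ^ k) \<le> \<mu> * s" for N
        using s sum_mono2[of "{..N}" "{..<N}" "\<lambda>k. pmf p k * s ^ k"] by (force intro: order_trans)
    qed (use s in auto)
    then have sr: "s \<le> r" using conv_radius_geI[of "pmf p" s] r s by simp
    show ?thesis
    proof (cases "s = r")
      case True
      have "(\<lambda>N. psum p N r) \<longlonglongrightarrow> gen_fun p r" unfolding gen_fun_def by (rule summable_LIMSEQ'[OF sm])
      then show ?thesis by (rule LIMSEQ_le_const2) (use s True in auto)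
    next
      case False
      have "psum p N r \<le> \<mu> * r" for N
      proof (rule tendsto_le)
        show "((\<lambda>t. psum p N t) \<longlongrightarrow> psum p N r) (at_left r)"
          by (intro tendsto_intros)
        show "((\<lambda>t. \<mu> * t) \<longlongrightarrow> \<mu> * r) (at_left r)" by (intro tendsto_intros)
        have "psum p N t \<le> \<mu> * t" if "s < t" "t < r" for t
        proof -
          have "psum p N t \<le> gen_fun p t" using that r s by (intro psum_le summable_gen_fun) auto
          also have "\<dots> \<le> \<mu> * t" using that s by (intro dec[of s]) auto
          finally show ?thesis .
        qed
        then show "\<forall>\<^sub>F t in at_left r. psum p N t \<le> \<mu> * t"
          using sr False by (auto simp: eventually_at_left_field intro!: exI[of _ s])
      qed simp
      moreover have "(\<lambda>N. psum p N r) \<longlonglongrightarrow> gen_fun p r" unfolding gen_fun_def by (rule summable_LIMSEQ'[OF sm])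
      ultimately show ?thesis by (meson LIMSEQ_le_const2)
    qed
  qed
  ultimately show ?thesis using r s0 by (intro exI[of _ r]) auto
qed

text \<open>Convergence of the series at \<open>s0\<close> gives continuity of \<open>f\<close> up to that point. So the left limit
defining \<open>R_const\<close> is the value \<open>s0 / f s0\<close>, also when \<open>s0\<close> is the radius of convergence.\<close>

lemma R_const_props:
  "R_const p > 0"
  "\<exists>r>0. \<forall>N. psum p N r \<le> 1 / R_const p * r"
  "0 < s \<Longrightarrow> (\<And>N. psum p N s \<le> \<mu> * s) \<Longrightarrow> 1 / R_const p \<le> \<mu>"
proof -
  obtain r where r: "r > 0" "s0 p = ereal r" "summable (\<lambda>k. pmf p k * r ^ k)"
    and m: "\<And>s \<mu>. 0 < s \<Longrightarrow> (\<And>N. psum p N s \<le> \<mu> * s) \<Longrightarrow> gen_fun p r \<le> \<mu> * r"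
    using s0_minimizer by blast
  have "continuous_on {0..r} (gen_fun p)"
    unfolding gen_fun_def[abs_def] by (rule continuous_on_power_series) (use r in simp)
  then have "(gen_fun p \<longlongrightarrow> gen_fun p r) (at r within {0..r})" using r unfolding continuous_on_def by auto
  then have "(gen_fun p \<longlongrightarrow> gen_fun p r) (at_left r)"
    using r at_within_Icc_at_left[of 0 r] by simp
  then have "((\<lambda>s. s / gen_fun p s) \<longlongrightarrow> r / gen_fun p r) (at_left r)"
    using gen_fun_pos[of r] r by (intro tendsto_divide tendsto_ident_at) auto
  then have "((\<lambda>s. real_of_ereal s / gen_fun p (real_of_ereal s)) \<longlongrightarrow> r / gen_fun p r) (at_left (ereal r))"
    unfolding at_left_ereal by (simp add: filterlim_filtermap)
  moreover have "at_left (ereal r) \<noteq> bot" unfolding at_left_ereal by (simp add: filtermap_bot_iff)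
  ultimately have R: "R_const p = r / gen_fun p r" unfolding R_const_def r(2) by (intro tendsto_Lim)
  show "R_const p > 0" unfolding R using gen_fun_pos[of r] r by simp
  show "\<exists>r>0. \<forall>N. psum p N r \<le> 1 / R_const p * r" unfolding R using r psum_le[of r] by (intro exI[of _ r]) auto
  show "1 / R_const p \<le> \<mu>" if "0 < s" "\<And>N. psum p N s \<le> \<mu> * s" for s \<mu>
    unfolding R using m[OF that] r by (simp add: field_simps)
qed

text \<open>Compactness: if for every truncation some \<open>s > 0\<close> violated the inequality, then these points would stay in a
compact interval away from \<open>0\<close>, because the terms of index \<open>0\<close> and \<open>d\<close> alone are too large outside. At a
limit point all partial sums would be at most \<open>\<mu> * s\<close>, which contradicts the minimality of \<open>1 / R\<close>.\<close>

lemma truncation: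
  assumes "0 < \<mu>" "\<mu> < 1 / R_const p"
  shows "\<exists>N\<ge>d. \<forall>s>0. psum p N s > \<mu> * s"
proof (rule ccontr)
  assume "\<not> ?thesis"
  then have "\<forall>N. \<exists>s>0. psum p (N + d) s \<le> \<mu> * s" by (metis le_add2 not_le)
  then obtain s where s: "\<And>N. s N > 0" "\<And>N. psum p (N + d) (s N) \<le> \<mu> * s N" by metis
  \<comment> \<open>beyond \<open>b\<close> the term of index \<open>d\<close> alone exceeds \<open>\<mu> * s\<close>\<close>
  define b where "b = max 1 (\<mu> / pmf p d)"
  have term_le: "pmf p j * s N ^ j \<le> \<mu> * s N" if "j \<le> d" for j N
  proof -
    have "(\<Sum>k\<in>{j}. pmf p k * s N ^ k) \<le> psum p (N + d) (s N)"
      using that s(1)[of N] by (intro sum_mono2) auto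
    then show ?thesis using s(2)[of N] by simp
  qed
  have rng: "s N \<in> {pmf p 0 / \<mu>..b}" for N
  proof -
    have "pmf p 0 \<le> \<mu> * s N" using term_le[of 0 N] by simp
    moreover have "s N \<le> b"
    proof (cases "s N \<le> 1")
      case False
      have "pmf p d * s N ^ 1 * s N \<le> pmf p d * s N ^ (d - 1) * s N"
        using d False by (intro mult_right_mono mult_left_mono power_increasing) auto
      also have "\<dots> = pmf p d * s N ^ d" using d by (cases d) auto
      also have "\<dots> \<le> \<mu> * s N" by (rule term_le) simp
      finally have "pmf p d * s N \<le> \<mu>" using s(1)[of N] by simp
      then have "s N \<le> \<mu> / pmf p d" using d by (simp add: field_simps)
      then show ?thesis by (simp add: b_def)
    qed (simp add: b_def)
    ultimately show ?thesis using assms by (simp add: field_simps)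
  qed
  have "seq_compact {pmf p 0 / \<mu>..b}" using compact_Icc compact_eq_seq_compact_metric by blast
  then obtain l g where l: "l \<in> {pmf p 0 / \<mu>..b}" "strict_mono (g :: nat \<Rightarrow> nat)" "(s \<circ> g) \<longlonglongrightarrow> l"
    using rng unfolding seq_compact_def by metis
  have "psum p N l \<le> \<mu> * l" for N
  proof (rule tendsto_le)
    show "(\<lambda>n. psum p N ((s \<circ> g) n)) \<longlonglongrightarrow> psum p N l" "(\<lambda>n. \<mu> * (s \<circ> g) n) \<longlonglongrightarrow> \<mu> * l"
      by (intro tendsto_intros l(3))+
    have "psum p N (s (g n)) \<le> \<mu> * s (g n)" if "n \<ge> N" for n
      using psum_mono[of "s (g n)" N "g n + d"] s[of "g n"] seq_suble[OF l(2), of n] that by simp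
    then show "\<forall>\<^sub>F n in sequentially. psum p N ((s \<circ> g) n) \<le> \<mu> * (s \<circ> g) n"
      by (auto simp: eventually_sequentially)
  qed simp
  moreover have "l > 0" using l(1) p0 assms by (auto intro: less_le_trans[rotated])
  ultimately have "1 / R_const p \<le> \<mu>" using R_const_props(3) by blast
  then show False using assms by simp
qed

end

section \<open>Eigenvector inequalities for the reproduction operator\<close>

text \<open>The tent function is linear with slope \<open>1\<close> or \<open>-1\<close> on either half, apart from convex kinks at its
feet, where cutting off at \<open>0\<close> only increases it. For a centred step of size at most \<open>N\<close> it is therefore
subharmonic away from its apex. Within distance of order \<open>N\<close> of the apex one step lowers it by at most \<open>N\<close>,
which is a small fraction of its height \<open>K / 2\<close>. This fraction is paid for by \<open>\<mu> < F\<close>.\<close>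

lemma tent_subharmonic:
  fixes w :: "nat \<Rightarrow> real" and F l K :: real
  assumes w: "\<And>a. w a \<ge> 0" and F: "(\<Sum>a\<le>N. w a) = F" and mean: "(\<Sum>a\<le>N. w a * (1 - real a)) = 0"
    and N: "N \<ge> 1" and \<mu>: "0 \<le> \<mu>" "\<mu> < F" and K: "(K / 2 - real N - 1) * (F - \<mu>) \<ge> F * real N"
  shows "\<mu> * max 0 (min l (K - l)) \<le> (\<Sum>a\<le>N. w a * max 0 (min (l + 1 - real a) (K - (l + 1 - real a))))"
proof -
  let ?G = "\<lambda>x. max 0 (min x (K - x)) :: real"
  have F0: "0 < F" using \<mu> by simp
  have lin: "(\<Sum>a\<le>N. w a * (c + e * (1 - real a))) = F * c" for c e :: real
  proof -
    have "(\<Sum>a\<le>N. w a * (c + e * (1 - real a))) = (\<Sum>a\<le>N. w a) * c + e * (\<Sum>a\<le>N. w a * (1 - real a))"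
      by (simp add: sum_distrib_left sum_distrib_right sum.distrib algebra_simps sum_subtractf)
    then show ?thesis using F mean by simp
  qed
  have pos: "0 \<le> (\<Sum>a\<le>N. w a * ?G (l + 1 - real a))" by (intro sum_nonneg mult_nonneg_nonneg w) auto
  have scale: "\<mu> * ?G l \<le> F * ?G l" using \<mu> by (intro mult_right_mono) auto
  consider "l + 1 \<le> K / 2" | "l - real N \<ge> K / 2" | "K / 2 - 1 < l" "l < K / 2 + real N" by linarith
  then show ?thesis
  proof cases
    case 1
    have "F * l = (\<Sum>a\<le>N. w a * (l + 1 * (1 - real a)))" by (rule lin[symmetric])
    also have "\<dots> \<le> (\<Sum>a\<le>N. w a * ?G (l + 1 - real a))"
      using 1 by (intro sum_mono mult_left_mono w) auto
    finally have "F * ?G l \<le> (\<Sum>a\<le>N. w a * ?G (l + 1 - real a))"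
      using pos 1 F0 by (auto simp: max_def min_def)
    with scale show ?thesis by simp
  next
    case 2
    have "F * (K - l) = (\<Sum>a\<le>N. w a * ((K - l) + (- 1) * (1 - real a)))" by (rule lin[symmetric])
    also have "\<dots> \<le> (\<Sum>a\<le>N. w a * ?G (l + 1 - real a))"
      using 2 by (intro sum_mono mult_left_mono w) auto
    finally have b: "F * (K - l) \<le> (\<Sum>a\<le>N. w a * ?G (l + 1 - real a))" .
    have "F * ?G l \<le> (\<Sum>a\<le>N. w a * ?G (l + 1 - real a))"
    proof -
      have "?G l = 0 \<or> ?G l = K - l" using 2 by auto
      then show ?thesis
      proof
        assume "?G l = 0"
        then show ?thesis using pos by (simp only: mult_zero_right)
      next
        assume "?G l = K - l"
        then show ?thesis using b by (simp only:)
      qed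
    qed
    with scale show ?thesis by simp
  next
    case 3
    have "F * (?G l - real N) = (\<Sum>a\<le>N. w a * ((?G l - real N) + 0 * (1 - real a)))" by (rule lin[symmetric])
    also have "\<dots> \<le> (\<Sum>a\<le>N. w a * ?G (l + 1 - real a))"
      using N by (intro sum_mono mult_left_mono w) (auto simp: max_def min_def)
    finally have a: "F * (?G l - real N) \<le> (\<Sum>a\<le>N. w a * ?G (l + 1 - real a))" .
    have "F * real N \<le> (K / 2 - real N - 1) * (F - \<mu>)" by (rule K)
    also have "\<dots> \<le> ?G l * (F - \<mu>)"
      using 3 \<mu> by (intro mult_right_mono) auto
    finally have "\<mu> * ?G l \<le> F * (?G l - real N)" by (simp add: algebra_simps)
    with a show ?thesis by simp
  qed
qed

context offspring
begin

text \<open>The weight is \<open>s powr (- l)\<close> times a tent. Here \<open>s\<close> solves \<open>s * f' s = f s\<close> for a truncated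
generating function, so the tilted weights \<open>p a * s ^ a\<close> give the step \<open>1 - a\<close> mean zero. Their total
mass exceeds \<open>\<mu> * s\<close> by the choice of the truncation.\<close>

lemma subeigenvector:
  assumes "0 < \<mu>" "\<mu> < 1 / R_const p"
  shows "\<exists>h K. (\<forall>l. 0 \<le> h l) \<and> 0 < h 1 \<and> h 0 = 0 \<and> (\<forall>l>K. h l = 0) \<and> (\<forall>l. \<mu> * h l \<le> reprod p h l)"
proof -
  obtain N where N: "N \<ge> d" "\<And>s. s > 0 \<Longrightarrow> psum p N s > \<mu> * s"
    using truncation[OF assms] by blast
  have "\<exists>s>0. (\<Sum>a\<le>N. pmf p a * s ^ a * (1 - real a)) = 0"
  proof -
    let ?g = "\<lambda>s. \<Sum>a\<le>N. pmf p a * s ^ a * (1 - real a)"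
    \<comment> \<open>at \<open>t\<close> the term of index \<open>d\<close> outweighs that of index \<open>0\<close>, so the sign has changed\<close>
    define t where "t = max 1 (pmf p 0 / pmf p d)"
    have t: "t \<ge> 1" "pmf p 0 \<le> pmf p d * t" using d unfolding t_def by (auto simp: field_simps max_def)
    have "?g t \<le> (\<Sum>a\<in>{0, d}. pmf p a * t ^ a * (1 - real a))"
    proof -
      have "(\<Sum>a\<in>{0, d}. pmf p a * t ^ a * (real a - 1)) \<le> (\<Sum>a\<le>N. pmf p a * t ^ a * (real a - 1))"
      proof (rule sum_mono2)
        show "0 \<le> pmf p b * t ^ b * (real b - 1)" if "b \<in> {..N} - {0, d}" for b
          using that t by (cases b) auto
      qed (use N in auto)
      moreover have "(\<Sum>a\<in>A. pmf p a * t ^ a * (1 - real a)) = - (\<Sum>a\<in>A. pmf p a * t ^ a * (real a - 1))" for A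
        by (simp add: sum_negf[symmetric] algebra_simps)
      ultimately show ?thesis by simp
    qed
    also have "\<dots> = pmf p 0 - pmf p d * t ^ d * (real d - 1)" using d by (simp add: algebra_simps)
    also have "\<dots> \<le> 0"
    proof -
      have "t * 1 \<le> t ^ d * (real d - 1)" using d t self_le_power[of t d] by (intro mult_mono) auto
      then have "pmf p d * t \<le> pmf p d * (t ^ d * (real d - 1))" by (intro mult_left_mono) auto
      then show ?thesis using t(2) by (simp add: mult.assoc)
    qed
    finally have "?g t \<le> 0" .
    moreover have g0: "?g 0 = pmf p 0"
      by (subst sum.mono_neutral_right[where S="{0}"]) auto
    ultimately obtain s where s: "0 \<le> s" "s \<le> t" "?g s = 0"
      using IVT2'[of ?g t 0 0] p0 t by (force intro!: continuous_intros)
    then have "s \<noteq> 0" using g0 p0 by auto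
    then show ?thesis using s by (intro exI[of _ s]) auto
  qed
  then obtain s where s: "s > 0" "(\<Sum>a\<le>N. pmf p a * s ^ a * (1 - real a)) = 0" by blast
  define F where "F = psum p N s"
  have F: "\<mu> * s < F" unfolding F_def by (rule N(2)[OF s(1)])
  \<comment> \<open>the width that \<open>tent_subharmonic\<close> asks for; the summand \<open>2\<close> gives \<open>K > 1\<close>, hence \<open>h 1 > 0\<close>\<close>
  define K :: nat where "K = nat \<lceil>2 * (F * real N / (F - \<mu> * s) + real N + 1)\<rceil> + 2"
  have "2 * (F * real N / (F - \<mu> * s) + real N + 1) \<le> real K" unfolding K_def by linarith
  then have "F * real N / (F - \<mu> * s) \<le> real K / 2 - real N - 1" by simp
  then have K: "F * real N \<le> (real K / 2 - real N - 1) * (F - \<mu> * s)" using F by (simp add: pos_divide_le_eq)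
  define G where "G = (\<lambda>x::real. max 0 (min x (real K - x)))"
  define h where "h = (\<lambda>l. G (real l) / s ^ l)"
  have G0: "G x = 0" if "x \<le> 0" for x using that by (simp add: G_def)
  have "\<mu> * h l \<le> reprod p h l" for l
  proof -
    have "\<mu> * s * G (real l) \<le> (\<Sum>a\<le>N. pmf p a * s ^ a * G (real l + 1 - real a))"
      unfolding G_def
    proof (rule tent_subharmonic[OF _ F_def[symmetric] s(2)])
      show "1 \<le> N" using N d by simp
    qed (use s assms F K in auto)
    also have "\<dots> \<le> (\<Sum>a\<le>l. pmf p a * s ^ a * G (real l + 1 - real a))"
    proof -
      have "(\<Sum>a\<le>N. pmf p a * s ^ a * G (real l + 1 - real a)) = (\<Sum>a\<in>{..N} \<inter> {..l}. pmf p a * s ^ a * G (real l + 1 - real a))"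
        by (rule sum.mono_neutral_right) (auto intro!: G0)
      also have "\<dots> \<le> (\<Sum>a\<le>l. pmf p a * s ^ a * G (real l + 1 - real a))"
        using s by (intro sum_mono2) (auto simp: G_def)
      finally show ?thesis .
    qed
    also have "\<dots> = (\<Sum>a\<le>l. s ^ Suc l * (pmf p a * h (Suc (l - a))))"
    proof (rule sum.cong[OF refl])
      fix a assume a: "a \<in> {..l}"
      then have "s ^ Suc l = s ^ a * s ^ Suc (l - a)" by (simp flip: power_add)
      moreover have "real (Suc (l - a)) = real l + 1 - real a" using a by (simp add: of_nat_diff)
      ultimately show "pmf p a * s ^ a * G (real l + 1 - real a) = s ^ Suc l * (pmf p a * h (Suc (l - a)))"
        unfolding h_def using s by (simp only:) simp
    qed
    also have "\<dots> = s ^ Suc l * reprod p h l" by (simp add: reprod_def sum_distrib_left)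
    finally have "s ^ Suc l * (\<mu> * h l) \<le> s ^ Suc l * reprod p h l"
      using s unfolding h_def by (simp add: field_simps)
    then show ?thesis using s by (simp del: power_Suc)
  qed
  moreover have "0 < h 1" "h 0 = 0" "\<forall>l>K. h l = 0" "\<forall>l. 0 \<le> h l"
    using s by (auto simp: h_def G_def K_def)
  ultimately show ?thesis by (intro exI[of _ h] exI[of _ K]) blast
qed

text \<open>On the weight \<open>(1 / r) ^ l\<close> the operator acts by a partial sum of \<open>f r / r\<close>.\<close>

lemma supereigenvector:
  "\<exists>r>0. \<forall>l. reprod p (\<lambda>l. (1 / r) ^ l) l \<le> 1 / R_const p * (1 / r) ^ l"
proof -
  obtain r where r: "r > 0" "\<And>N. psum p N r \<le> 1 / R_const p * r" using R_const_props(2) by blast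
  have "reprod p (\<lambda>l. (1 / r) ^ l) l \<le> 1 / R_const p * (1 / r) ^ l" for l
  proof -
    have "reprod p (\<lambda>l. (1 / r) ^ l) l = (1 / r) ^ Suc l * psum p l r"
      unfolding reprod_def sum_distrib_left
    proof (rule sum.cong[OF refl])
      fix a assume a: "a \<in> {..l}"
      then have "(1 / r) ^ Suc l = (1 / r) ^ a * (1 / r) ^ Suc (l - a)" by (simp flip: power_add)
      then show "pmf p a * (1 / r) ^ Suc (l - a) = (1 / r) ^ Suc l * (pmf p a * r ^ a)"
        using r by (simp add: power_one_over)
    qed
    also have "\<dots> \<le> (1 / r) ^ Suc l * (1 / R_const p * r)" using r by (intro mult_left_mono) auto
    also have "\<dots> = 1 / R_const p * (1 / r) ^ l" using r by simp
    finally show ?thesis .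
  qed
  then show ?thesis using r by blast
qed

end

section \<open>Almost sure growth along powers of two\<close>

lemma less_two_power: "r \<ge> k \<Longrightarrow> k \<le> 2 ^ r"
  by (meson less_exp less_imp_le order_trans)

lemma summable_two_powr:
  fixes c :: real assumes "c < 0" shows "summable (\<lambda>r::nat. C * 2 powr (real r * c))"
proof -
  have "summable (\<lambda>r. C * (2 powr c) ^ r)"
    using assms by (intro summable_mult summable_geometric) (simp add: powr_less_one)
  then show ?thesis by (simp add: powr_power)
qed

context random_tree_model
begin

text \<open>The Markov inequality combined with the first Borel-Cantelli lemma.\<close>

lemma eventually_below:
  fixes Y :: "nat \<Rightarrow> (nat \<Rightarrow> nat) \<Rightarrow> (nat \<Rightarrow> nat) \<Rightarrow> real" and c t :: "nat \<Rightarrow> real"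
  assumes ad: "\<And>r. r \<ge> start \<Longrightarrow> adapted (a r) (Y r)"
    and c: "\<And>r. r \<ge> start \<Longrightarrow> (\<integral>\<^sup>+\<omega>. ennreal (Y r (ZZ \<omega>) (VV \<omega>)) \<partial>M) \<le> ennreal (c r)"
    and c0: "\<And>r. r \<ge> start \<Longrightarrow> 0 \<le> c r" and t: "\<And>r. r \<ge> start \<Longrightarrow> 0 < t r"
    and sm: "summable (\<lambda>r. c r / t r)"
  shows "AE \<omega> in M. \<forall>\<^sub>F r in sequentially. Y r (ZZ \<omega>) (VV \<omega>) < t r"
proof -
  let ?Y = "\<lambda>r \<omega>. Y (r + start) (ZZ \<omega>) (VV \<omega>)"
  let ?A = "\<lambda>r. {\<omega> \<in> space M. t (r + start) \<le> ?Y r \<omega>}"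
  have meas: "?Y r \<in> borel_measurable M" for r
    by (rule measurable_adapted[OF ad]) auto
  have sets: "?A r \<in> sets M" for r using meas by measurable
  have bound: "measure M (?A r) \<le> c (r + start) / t (r + start)" for r
  proof -
    have t': "0 < t (r + start)" and c': "0 \<le> c (r + start)" using t c0 by auto
    have "emeasure M (?A r) \<le> emeasure M {\<omega> \<in> space M. 1 \<le> ennreal (1 / t (r + start)) * ennreal (?Y r \<omega>)}"
    proof (rule emeasure_mono)
      show "{\<omega> \<in> space M. 1 \<le> ennreal (1 / t (r + start)) * ennreal (?Y r \<omega>)} \<in> sets M" using meas by measurable
      have "1 \<le> ennreal (1 / t (r + start)) * ennreal (?Y r \<omega>)" if "t (r + start) \<le> ?Y r \<omega>" for \<omega>
        using that t' by (subst ennreal_mult[symmetric]) auto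
      then show "?A r \<subseteq> {\<omega> \<in> space M. 1 \<le> ennreal (1 / t (r + start)) * ennreal (?Y r \<omega>)}" by auto
    qed
    also have "\<dots> \<le> ennreal (1 / t (r + start)) * (\<integral>\<^sup>+\<omega>. ennreal (?Y r \<omega>) \<partial>M)"
      using nn_integral_Markov_inequality[of "\<lambda>\<omega>. ennreal (?Y r \<omega>)" "space M" M "ennreal (1 / t (r + start))"] meas
      by (simp cong: nn_integral_cong)
    also have "\<dots> \<le> ennreal (1 / t (r + start)) * ennreal (c (r + start))" by (intro mult_left_mono c) auto
    also have "\<dots> = ennreal (c (r + start) / t (r + start))" using t' c' by (simp add: ennreal_mult[symmetric])
    finally show ?thesis using t' c' by (simp add: emeasure_eq_measure)
  qed
  have "AE \<omega> in M. \<forall>\<^sub>F r in sequentially. \<omega> \<in> space M - ?A r"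
  proof (rule borel_cantelli_AE1)
    show "summable (\<lambda>r. measure M (?A r))"
      by (rule summable_comparison_test'[OF summable_ignore_initial_segment[OF sm, of start]]) (use bound in auto)
  qed (use sets in \<open>auto simp: emeasure_eq_measure\<close>)
  then show ?thesis
  proof eventually_elim
    case (elim \<omega>)
    then have "\<forall>\<^sub>F r in sequentially. ?Y r \<omega> < t (r + start)" by eventually_elim auto
    then show ?case by (rule eventually_sequentially_seg[THEN iffD1])
  qed
qed

lemma upper_dyadic:
  assumes k: "k \<ge> 1" and \<gamma>: "0 < \<gamma>" and \<epsilon>: "0 < \<epsilon>" and h: "\<And>l. 0 \<le> h l" "h 0 = 1" "\<And>l. reprod p h l \<le> \<gamma> * h l"
  shows "AE \<omega> in M. \<forall>\<^sub>F r in sequentially. pop k h (2 ^ r) (ZZ \<omega>) (VV \<omega>) < 2 powr (real r * \<gamma>) * real r powr (1 + \<epsilon>)"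
proof (rule eventually_below[where start="Suc k" and c="\<lambda>r. 2 powr (real r * \<gamma>)" and a="\<lambda>r. 2 ^ r"])
  show "adapted (2 ^ r) (pop k h (2 ^ r))" for r by (rule adapted_pop[OF k])
  have T: "adapted n (\<lambda>z v. True)" for n by (simp add: adapted_def)
  fix r assume r: "Suc k \<le> r"
  then have kr: "k \<le> 2 ^ r" using less_two_power[of k r] by simp
  have "(\<integral>\<^sup>+\<omega>. ennreal (if True then pop k h (2 ^ r) (ZZ \<omega>) (VV \<omega>) else 0) \<partial>M) \<le>
     ennreal (exp (\<gamma> * (\<Sum>i\<in>{k..<2 ^ r}. 1 / real (Suc i)))) *
     (\<integral>\<^sup>+\<omega>. ennreal (if True then pop k h k (ZZ \<omega>) (VV \<omega>) else 0) \<partial>M)"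
  proof (rule moment_bound[where \<phi>="\<lambda>w. w" and \<beta>="\<lambda>_. 1" and P="\<lambda>z v. True", OF k order.refl T h(1) _ _ _ kr])
    show "1 * pop k (reprod p h) n z v \<le> \<gamma> * pop k h n z v" for n z v
      using pop_weight_mono[OF h(3), where k=k and n=n and z=z and v=v] by (simp add: pop_cmult)
  qed auto
  also have "\<dots> = ennreal (exp (\<gamma> * (\<Sum>i\<in>{k..<2 ^ r}. 1 / real (Suc i))))"
    by (simp add: pop_start[OF k] h(2) emeasure_space_1)
  also have "\<dots> \<le> ennreal (2 powr (real r * \<gamma>))"
  proof (rule ennreal_leI)
    have "(\<Sum>i\<in>{k..<2 ^ r}. 1 / real (Suc i)) \<le> ln (real (2 ^ r) / real k)"
      by (rule harmonic_upper[OF k kr])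
    also have "\<dots> \<le> ln (2 ^ r)" using k by (simp add: ln_div)
    finally have "\<gamma> * (\<Sum>i\<in>{k..<2 ^ r}. 1 / real (Suc i)) \<le> \<gamma> * ln (2 ^ r)" using \<gamma> by (intro mult_left_mono) auto
    also have "\<gamma> * ln (2 ^ r) = real r * \<gamma> * ln 2" by (simp add: ln_realpow)
    finally show "exp (\<gamma> * (\<Sum>i\<in>{k..<2 ^ r}. 1 / real (Suc i))) \<le> 2 powr (real r * \<gamma>)"
      by (simp add: powr_def)
  qed
  finally show "(\<integral>\<^sup>+\<omega>. ennreal (pop k h (2 ^ r) (ZZ \<omega>) (VV \<omega>)) \<partial>M) \<le> ennreal (2 powr (real r * \<gamma>))" by simp
next
  have "summable (\<lambda>r. real r powr (- (1 + \<epsilon>)))" using \<epsilon> by (simp add: summable_real_powr_iff)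
  moreover have "2 powr (real r * \<gamma>) / (2 powr (real r * \<gamma>) * real r powr (1 + \<epsilon>)) = real r powr (- (1 + \<epsilon>))" for r
    unfolding powr_minus by (simp add: divide_inverse)
  ultimately show "summable (\<lambda>r. 2 powr (real r * \<gamma>) / (2 powr (real r * \<gamma>) * real r powr (1 + \<epsilon>)))"
    by presburger
qed auto

text \<open>Members of generation \<open>j\<close> with step length \<open>a\<close> produce members of generation \<open>j + 1 - a\<close>. If at
least \<open>x\<close> such sources are present from time \<open>m\<close> on, each step produces one with probability at least
\<open>p a * x / (n + 1)\<close>. An indicator \<open>y\<close> satisfies \<open>2 powr (- y) = 1 - y / 2\<close>, hence the rate
\<open>p a * x / 2\<close>.\<close>

lemma source_moment:
  assumes k: "k \<ge> 1" "k \<le> m" "m \<le> N" and P: "adapted m P"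
    and x: "0 \<le> x" "\<And>z v. P z v \<Longrightarrow> x \<le> pop k (gen_ind j) m z v" and a: "a \<le> j"
  shows "(\<integral>\<^sup>+\<omega>. ennreal (if P (ZZ \<omega>) (VV \<omega>) then 2 powr (- pop k (gen_ind (Suc (j - a))) N (ZZ \<omega>) (VV \<omega>)) else 0) \<partial>M)
    \<le> ennreal (((real m + 1) / (real N + 1)) powr (pmf p a * x / 2))"
proof -
  let ?h = "gen_ind (Suc (j - a))" let ?\<gamma> = "- (pmf p a * x / 2)"
  let ?S = "\<Sum>i\<in>{m..<N}. 1 / real (Suc i)"
  have "(\<integral>\<^sup>+\<omega>. ennreal (if P (ZZ \<omega>) (VV \<omega>) then 2 powr (- pop k ?h N (ZZ \<omega>) (VV \<omega>)) else 0) \<partial>M)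
    \<le> ennreal (exp (?\<gamma> * ?S)) *
     (\<integral>\<^sup>+\<omega>. ennreal (if P (ZZ \<omega>) (VV \<omega>) then 2 powr (- pop k ?h m (ZZ \<omega>) (VV \<omega>)) else 0) \<partial>M)"
  proof (rule moment_bound[where \<phi>="\<lambda>w. 2 powr (- w)" and \<beta>="\<lambda>w. - (2 powr (- w) / 2)", OF k(1,2) P _ _ _ _ k(3)])
    fix n z v and y :: real assume "m \<le> n" "P z v" "y = 0 \<or> y \<in> range ?h"
    then have "y = 0 \<or> y = 1" by (auto simp: gen_ind_def split: if_splits)
    then show "2 powr - (pop k ?h n z v + y) \<le> 2 powr - pop k ?h n z v + - (2 powr - pop k ?h n z v / 2) * y"
      by (auto simp: powr_diff powr_minus_divide powr_add)
  next
    fix n z v assume n: "m \<le> n" "P z v"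
    have "pmf p a * gen_ind j l \<le> reprod p ?h l" for l
    proof (cases "l = j")
      case True
      have "(\<Sum>b\<in>{a}. pmf p b * ?h (Suc (j - b))) \<le> reprod p ?h j"
        unfolding reprod_def using a by (intro sum_mono2) auto
      then show ?thesis using True by (simp add: gen_ind_def)
    next
      case False
      then show ?thesis by (auto simp: gen_ind_def reprod_def intro!: sum_nonneg)
    qed
    then have "pmf p a * pop k (gen_ind j) n z v \<le> pop k (reprod p ?h) n z v"
      unfolding pop_cmult[symmetric] by (rule pop_weight_mono)
    moreover have "x \<le> pop k (gen_ind j) n z v"
      using x(2)[OF n(2)] pop_mono[of "gen_ind j" m n k z v] n(1) by simp
    ultimately have "pmf p a * x \<le> pop k (reprod p ?h) n z v"
      by (meson mult_left_mono order_trans pmf_nonneg)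
    then have "2 powr (- pop k ?h n z v) / 2 * (pmf p a * x) \<le> 2 powr (- pop k ?h n z v) / 2 * pop k (reprod p ?h) n z v"
      by (intro mult_left_mono) auto
    then show "- (2 powr (- pop k ?h n z v) / 2) * pop k (reprod p ?h) n z v \<le> ?\<gamma> * 2 powr (- pop k ?h n z v)"
      by simp
  qed auto
  also have "\<dots> \<le> ennreal (exp (?\<gamma> * ?S)) * (\<integral>\<^sup>+\<omega>. 1 \<partial>M)"
  proof (intro mult_left_mono nn_integral_mono)
    have "pop k ?h m z v \<ge> 0" for z v by (rule pop_nonneg) simp
    then have "2 powr (- pop k ?h m z v) \<le> 2 powr 0" for z v by (intro powr_mono) auto
    then show "ennreal (if P (ZZ \<omega>) (VV \<omega>) then 2 powr (- pop k ?h m (ZZ \<omega>) (VV \<omega>)) else 0) \<le> 1" for \<omega>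
      by (auto simp: ennreal_le_1)
  qed auto
  also have "\<dots> = ennreal (exp (?\<gamma> * ?S))" by (simp add: emeasure_space_1)
  also have "\<dots> \<le> ennreal (((real m + 1) / (real N + 1)) powr (pmf p a * x / 2))"
  proof (rule ennreal_leI)
    have "exp (?\<gamma> * ?S) \<le> exp (?\<gamma> * ln ((real N + 1) / (real m + 1)))"
      using harmonic_lower[OF k(3)] x(1) by (simp add: mult_left_mono)
    also have "\<dots> = ((real m + 1) / (real N + 1)) powr (pmf p a * x / 2)"
      by (simp add: powr_def ln_div algebra_simps)
    finally show "exp (?\<gamma> * ?S) \<le> ((real m + 1) / (real N + 1)) powr (pmf p a * x / 2)" .
  qed
  finally show ?thesis .
qed

text \<open>The vertex \<open>k\<close> itself is a permanent source of children, selected with step length \<open>0\<close>.\<close>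

lemma children_unbounded:
  assumes k: "k \<ge> 1" and p0: "0 < pmf p 0"
  shows "AE \<omega> in M. \<exists>n\<ge>k. c \<le> pop k (gen_ind 1) n (ZZ \<omega>) (VV \<omega>)"
proof -
  let ?Y = "\<lambda>r z v. if True then 2 powr (- pop k (gen_ind (Suc (0 - 0))) (2 ^ r) z v) else 0"
  let ?c = "\<lambda>r. ((real k + 1) / (real (2 ^ r) + 1)) powr (pmf p 0 * 1 / 2)"
  have T: "adapted n (\<lambda>z v. True)" for n by (simp add: adapted_def)
  have "AE \<omega> in M. \<forall>\<^sub>F r in sequentially. ?Y r (ZZ \<omega>) (VV \<omega>) < 2 powr (- c)"
  proof (rule eventually_below[where start=k and c="?c"])
    fix r assume r: "k \<le> r"
    show "adapted (2 ^ r) (?Y r)" by (rule adapted_guard[where m=0, OF k T]) simp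
    show "(\<integral>\<^sup>+\<omega>. ennreal (?Y r (ZZ \<omega>) (VV \<omega>)) \<partial>M) \<le> ennreal (?c r)"
      using source_moment[where k=k and m=k and N="2 ^ r" and P="\<lambda>z v. True" and x=1 and j=0 and a=0]
        k T less_two_power[OF r] pop_self[OF k] by auto
  next
    have "summable (\<lambda>r. ((real k + 1) powr (pmf p 0 / 2) / 2 powr (- c)) * (2 powr (- (pmf p 0 / 2))) ^ r)"
      using p0 by (intro summable_mult summable_geometric) (simp add: powr_less_one)
    then show "summable (\<lambda>r. ?c r / 2 powr (- c))"
    proof (rule summable_comparison_test'[where N=0])
      fix r :: nat
      have "?c r \<le> ((real k + 1) / (real (2 ^ r))) powr (pmf p 0 / 2)"
        unfolding mult_1_right using p0 by (intro powr_mono2 divide_left_mono mult_pos_pos add_pos_pos) auto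
      also have "\<dots> = (real k + 1) powr (pmf p 0 / 2) * (2 powr (- (pmf p 0 / 2))) ^ r"
      proof -
        have "real (2 ^ r) powr (pmf p 0 / 2) = 2 powr (real r * (pmf p 0 / 2))"
          by (simp add: powr_realpow[symmetric] powr_powr)
        moreover have "(2 powr (- (pmf p 0 / 2))) ^ r = inverse (2 powr (real r * (pmf p 0 / 2)))"
          by (subst powr_power, simp, simp only: mult_minus_right powr_minus)
        moreover have "((real k + 1) / real (2 ^ r)) powr (pmf p 0 / 2) = (real k + 1) powr (pmf p 0 / 2) / real (2 ^ r) powr (pmf p 0 / 2)"
          by (rule powr_divide)
        ultimately show ?thesis by (metis divide_inverse)
      qed
      finally show "norm (?c r / 2 powr (- c)) \<le> ((real k + 1) powr (pmf p 0 / 2) / 2 powr (- c)) * (2 powr (- (pmf p 0 / 2))) ^ r"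
        by (simp add: divide_right_mono)
    qed
  qed auto
  then show ?thesis
  proof eventually_elim
    case (elim \<omega>)
    then have "\<forall>\<^sub>F r in sequentially. ?Y r (ZZ \<omega>) (VV \<omega>) < 2 powr (- c) \<and> r \<ge> k"
      using eventually_ge_at_top eventually_conj by blast
    from eventually_happens'[OF sequentially_bot this]
    obtain r where r: "?Y r (ZZ \<omega>) (VV \<omega>) < 2 powr (- c)" "k \<le> r" by blast
    then have "c \<le> pop k (gen_ind 1) (2 ^ r) (ZZ \<omega>) (VV \<omega>)" by simp
    then show ?case using less_two_power[OF r(2)] by blast
  qed
qed

text \<open>With \<open>w\<close> for the population, a jump \<open>x \<le> H\<close> gives
\<open>1 / (w + x) \<le> 1 / w - x / (w * (w + H))\<close>, so the reciprocal decreases at the relative rate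
\<open>\<kappa> * w / (w + H)\<close>. On the event that \<open>w \<ge> c\<close> at time \<open>m\<close> this rate is at least
\<open>\<nu> = \<kappa> * c / (c + H)\<close>, which exceeds \<open>\<mu>\<close> for large \<open>c\<close>. The union of these events over \<open>m\<close> has full
probability by \<open>children_unbounded\<close>.\<close>

lemma lower_dyadic:
  assumes k: "k \<ge> 1" and p0: "0 < pmf p 0" and \<mu>: "0 < \<mu>" "\<mu> < \<kappa>"
    and h: "\<And>l. 0 \<le> h l" "\<And>l. h l \<le> H" "0 < h 1" "\<And>l. \<kappa> * h l \<le> reprod p h l"
  shows "AE \<omega> in M. \<forall>\<^sub>F r in sequentially. 2 powr (real r * \<mu>) < pop k h (2 ^ r) (ZZ \<omega>) (VV \<omega>)"
proof -
  have H: "0 < H" using h(2,3) less_le_trans by blast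
  \<comment> \<open>large enough for \<open>\<kappa> * c / (c + H) > \<mu>\<close>\<close>
  define c where "c = \<mu> * H / (\<kappa> - \<mu>) + 1"
  have c: "0 < c" using \<mu> H by (simp add: c_def add_pos_pos)
  define \<nu> where "\<nu> = \<kappa> * c / (c + H)"
  have "c * (\<kappa> - \<mu>) = \<mu> * H + (\<kappa> - \<mu>)" using \<mu> by (simp add: c_def distrib_right)
  then have "\<mu> * H < c * (\<kappa> - \<mu>)" using \<mu> by simp
  then have \<nu>: "\<mu> < \<nu>" using c H by (simp add: \<nu>_def field_simps)
  let ?P = "\<lambda>m z v. c \<le> pop k h m z v"
  let ?Y = "\<lambda>m r z v. if ?P m z v then 1 / pop k h (2 ^ r) z v else 0"
  have A: "AE \<omega> in M. \<forall>\<^sub>F r in sequentially. ?Y m r (ZZ \<omega>) (VV \<omega>) < 2 powr (- (real r * \<mu>))" if m: "m \<ge> k" for m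
  proof (rule eventually_below[where start=m and c="\<lambda>r. (real m + 1) powr \<nu> / c * 2 powr (- (real r * \<nu>))"])
    fix r assume r: "m \<le> r"
    then have mr: "m \<le> 2 ^ r" by (rule less_two_power)
    show "adapted (2 ^ r) (?Y m r)" by (rule adapted_guard[OF k adapted_le_pop[OF k] mr])
    let ?S = "\<Sum>i\<in>{m..<2 ^ r}. 1 / real (Suc i)"
    have "(\<integral>\<^sup>+\<omega>. ennreal (?Y m r (ZZ \<omega>) (VV \<omega>)) \<partial>M) \<le> ennreal (exp ((- \<nu>) * ?S)) *
      (\<integral>\<^sup>+\<omega>. ennreal (if ?P m (ZZ \<omega>) (VV \<omega>) then 1 / pop k h m (ZZ \<omega>) (VV \<omega>) else 0) \<partial>M)"
    proof (rule moment_bound[where \<phi>="\<lambda>w. 1 / w" and \<beta>="\<lambda>w. - (1 / (w * (w + H)))", OF k m adapted_le_pop[OF k] h(1) _ _ _ mr])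
      fix n z v and x :: real assume n: "m \<le> n" "?P m z v"
      let ?w = "pop k h n z v"
      have w: "c \<le> ?w" using n pop_mono[where h=h, OF h(1) n(1), of k z v] by linarith
      { assume "x = 0 \<or> x \<in> range h"
        then have x: "0 \<le> x" "x \<le> H" using h H by auto
        have "1 / (?w + x) = 1 / ?w - x / (?w * (?w + x))" using w c x by (simp add: divide_simps)
        also have "\<dots> \<le> 1 / ?w - x / (?w * (?w + H))"
          using w c x H by (intro diff_left_mono divide_left_mono mult_left_mono mult_pos_pos add_pos_nonneg) auto
        finally show "1 / (?w + x) \<le> 1 / ?w + - (1 / (?w * (?w + H))) * x" by simp }
      have "\<kappa> * ?w \<le> pop k (reprod p h) n z v"
        unfolding pop_cmult[symmetric] by (rule pop_weight_mono[OF h(4)])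
      moreover have "\<nu> * (?w + H) \<le> \<kappa> * ?w"
      proof -
        have "c * H \<le> ?w * H" using w H by simp
        then have "c * (?w + H) \<le> ?w * (c + H)" by (simp add: algebra_simps)
        then have "\<kappa> * (c * (?w + H)) \<le> \<kappa> * (?w * (c + H))" using \<mu> by (intro mult_left_mono) auto
        then show ?thesis using c H by (simp add: \<nu>_def field_simps)
      qed
      ultimately have "\<nu> * (?w + H) \<le> pop k (reprod p h) n z v" by linarith
      then have "\<nu> * (?w + H) / (?w * (?w + H)) \<le> pop k (reprod p h) n z v / (?w * (?w + H))"
        using w c H by (intro divide_right_mono) auto
      then show "- (1 / (?w * (?w + H))) * pop k (reprod p h) n z v \<le> - \<nu> * (1 / ?w)"
        using w c H by simp
    qed auto
    also have "\<dots> \<le> ennreal (exp ((- \<nu>) * ?S)) * (\<integral>\<^sup>+\<omega>. ennreal (1 / c) \<partial>M)"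
      using c by (intro mult_left_mono nn_integral_mono) (auto intro!: ennreal_leI divide_left_mono)
    also have "\<dots> = ennreal (exp ((- \<nu>) * ?S) * (1 / c))"
      by (simp add: emeasure_space_1 ennreal_mult'[symmetric])
    also have "\<dots> \<le> ennreal ((real m + 1) powr \<nu> / c * 2 powr (- (real r * \<nu>)))"
    proof (rule ennreal_leI)
      have "exp ((- \<nu>) * ?S) \<le> exp ((- \<nu>) * ln ((real (2 ^ r) + 1) / (real m + 1)))"
        using harmonic_lower[OF mr] \<nu> \<mu> by simp
      also have "\<dots> = (real m + 1) powr \<nu> * (real (2 ^ r) + 1) powr (- \<nu>)"
      proof -
        have "1 + 2 ^ r \<noteq> (0::real)" using zero_less_power[of "2::real" r] by linarith
        then show ?thesis by (simp add: powr_def ln_div exp_add[symmetric] algebra_simps)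
      qed
      also have "(real (2 ^ r) + 1) powr (- \<nu>) \<le> real (2 ^ r) powr (- \<nu>)"
        using \<nu> \<mu> by (intro powr_mono2') auto
      also have "real (2 ^ r) powr (- \<nu>) = 2 powr (- (real r * \<nu>))"
        by (simp add: powr_realpow[symmetric] powr_powr)
      finally show "exp ((- \<nu>) * ?S) * (1 / c) \<le> (real m + 1) powr \<nu> / c * 2 powr (- (real r * \<nu>))"
        using c by (simp add: divide_right_mono mult_left_mono)
    qed
    finally show "(\<integral>\<^sup>+\<omega>. ennreal (?Y m r (ZZ \<omega>) (VV \<omega>)) \<partial>M) \<le> ennreal ((real m + 1) powr \<nu> / c * 2 powr (- (real r * \<nu>)))" .
  next
    have "(\<lambda>r. (real m + 1) powr \<nu> / c * 2 powr (- (real r * \<nu>)) / 2 powr (- (real r * \<mu>)))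
      = (\<lambda>r. (real m + 1) powr \<nu> / c * 2 powr (real r * (\<mu> - \<nu>)))"
    proof (intro ext)
      fix r :: nat
      have "2 powr (- (real r * \<nu>)) / 2 powr (- (real r * \<mu>)) = 2 powr (real r * (\<mu> - \<nu>))"
        unfolding powr_diff[symmetric] by (simp add: algebra_simps)
      then show "(real m + 1) powr \<nu> / c * 2 powr (- (real r * \<nu>)) / 2 powr (- (real r * \<mu>))
        = (real m + 1) powr \<nu> / c * 2 powr (real r * (\<mu> - \<nu>))"
        by (simp only: times_divide_eq_right[symmetric])
    qed
    then show "summable (\<lambda>r. (real m + 1) powr \<nu> / c * 2 powr (- (real r * \<nu>)) / 2 powr (- (real r * \<mu>)))"
      using summable_two_powr[of "\<mu> - \<nu>"] \<nu> by simp
  qed (use c in auto)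
  have "AE \<omega> in M. \<forall>m\<in>{k..}. \<forall>\<^sub>F r in sequentially. ?Y m r (ZZ \<omega>) (VV \<omega>) < 2 powr (- (real r * \<mu>))"
    using A by (subst AE_ball_countable) auto
  moreover have "AE \<omega> in M. \<exists>n\<ge>k. c / h 1 \<le> pop k (gen_ind 1) n (ZZ \<omega>) (VV \<omega>)"
    by (rule children_unbounded[OF k p0])
  ultimately show ?thesis
  proof eventually_elim
    case (elim \<omega>)
    then obtain m where m: "m \<ge> k" "c / h 1 \<le> pop k (gen_ind 1) m (ZZ \<omega>) (VV \<omega>)" by blast
    have "c \<le> h 1 * pop k (gen_ind 1) m (ZZ \<omega>) (VV \<omega>)" using m(2) h(3) by (simp add: field_simps)
    also have "\<dots> \<le> pop k h m (ZZ \<omega>) (VV \<omega>)"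
      unfolding pop_cmult[symmetric] using h by (intro pop_weight_mono) (auto simp: gen_ind_def)
    finally have P: "?P m (ZZ \<omega>) (VV \<omega>)" .
    have "\<forall>\<^sub>F r in sequentially. ?Y m r (ZZ \<omega>) (VV \<omega>) < 2 powr (- (real r * \<mu>)) \<and> m \<le> r"
      using elim(1) m eventually_ge_at_top[of m] by (intro eventually_conj) auto
    then show ?case
    proof eventually_elim
      case (elim r)
      have "?P (2 ^ r) (ZZ \<omega>) (VV \<omega>)"
        using P pop_mono[where h=h, OF h(1) less_two_power[of m r], of k "ZZ \<omega>" "VV \<omega>"] elim by linarith
      then show ?case using elim P c by (simp add: powr_minus divide_simps)
    qed
  qed
qed

section \<open>Transfer of growth between generations\<close>

text \<open>Between \<open>2 ^ r\<close> and \<open>2 ^ (r + 1)\<close> the factor \<open>(m + 1) / (N + 1)\<close> of \<open>source_moment\<close> is at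
most \<open>2 / 3\<close>, so the exponential moment is at most \<open>exp (- (p a * x * \<tau> / 2))\<close> with \<open>\<tau> = ln (3 / 2)\<close>.
Comparing with half that exponent leaves a summable error, because \<open>x\<close> grows like a power of \<open>2 ^ r\<close>.\<close>

lemma transfer:
  assumes k: "k \<ge> 1" and a: "a \<le> j" "0 < pmf p a" and b: "0 < b" and \<mu>: "0 < \<mu>"
  shows "\<exists>b'>0. AE \<omega> in M. \<forall>\<^sub>F r in sequentially. b * 2 powr (real r * \<mu>) \<le> pop k (gen_ind j) (2 ^ r) (ZZ \<omega>) (VV \<omega>)
     \<longrightarrow> b' * 2 powr (real (Suc r) * \<mu>) \<le> pop k (gen_ind (Suc (j - a))) (2 ^ Suc r) (ZZ \<omega>) (VV \<omega>)"
proof -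
  let ?i = "Suc (j - a)" let ?x = "\<lambda>r. b * 2 powr (real r * \<mu>)"
  define \<tau> :: real where "\<tau> = ln (3 / 2)"
  have \<tau>: "0 < \<tau>" by (simp add: \<tau>_def)
  let ?P = "\<lambda>r z v. ?x r \<le> pop k (gen_ind j) (2 ^ r) z v"
  let ?Y = "\<lambda>r z v. if ?P r z v then 2 powr (- pop k (gen_ind ?i) (2 ^ Suc r) z v) else 0"
  have Y: "AE \<omega> in M. \<forall>\<^sub>F r in sequentially. ?Y r (ZZ \<omega>) (VV \<omega>) < exp (- (pmf p a * ?x r * \<tau> / 4))"
  proof (rule eventually_below[where start=k and c="\<lambda>r. exp (- (pmf p a * ?x r * \<tau> / 2))"])
    fix r assume r: "k \<le> r"
    show "adapted (2 ^ Suc r) (?Y r)"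
      by (rule adapted_guard[OF k adapted_le_pop[OF k, of "2 ^ r"]]) simp
    have "(\<integral>\<^sup>+\<omega>. ennreal (?Y r (ZZ \<omega>) (VV \<omega>)) \<partial>M)
      \<le> ennreal (((real (2 ^ r) + 1) / (real (2 ^ Suc r) + 1)) powr (pmf p a * ?x r / 2))"
      by (rule source_moment[OF k less_two_power[OF r] _ adapted_le_pop[OF k] _ _ a(1)]) (use b in auto)
    also have "\<dots> \<le> ennreal (exp (- (pmf p a * ?x r * \<tau> / 2)))"
    proof (rule ennreal_leI)
      have "((real (2 ^ r) + 1) / (real (2 ^ Suc r) + 1)) \<le> 2 / 3" by (simp add: divide_simps)
      then have "((real (2 ^ r) + 1) / (real (2 ^ Suc r) + 1)) powr (pmf p a * ?x r / 2) \<le> (2 / 3) powr (pmf p a * ?x r / 2)"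
        using b by (intro powr_mono2) auto
      also have "\<dots> = exp (- (pmf p a * ?x r * \<tau> / 2))"
      proof -
        have "ln (2 / 3 :: real) = - \<tau>" by (simp add: \<tau>_def ln_div)
        then show ?thesis by (simp add: powr_def)
      qed
      finally show "((real (2 ^ r) + 1) / (real (2 ^ Suc r) + 1)) powr (pmf p a * ?x r / 2) \<le> exp (- (pmf p a * ?x r * \<tau> / 2))" .
    qed
    finally show "(\<integral>\<^sup>+\<omega>. ennreal (?Y r (ZZ \<omega>) (VV \<omega>)) \<partial>M) \<le> ennreal (exp (- (pmf p a * ?x r * \<tau> / 2)))" .
  next
    \<comment> \<open>\<open>2 powr y \<ge> y * ln 2\<close> bounds the error by a geometric series with ratio \<open>exp (- q)\<close>\<close>
    define q where "q = pmf p a * \<tau> * b / 4 * (\<mu> * ln 2)"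
    have q: "0 < q" using a b \<tau> \<mu> by (simp add: q_def)
    have "summable (\<lambda>r. exp (- q) ^ r)" using q by (intro summable_geometric) simp
    then show "summable (\<lambda>r. exp (- (pmf p a * ?x r * \<tau> / 2)) / exp (- (pmf p a * ?x r * \<tau> / 4)))"
    proof (rule summable_comparison_test'[where N=0])
      fix r :: nat
      have "real r * \<mu> * ln 2 \<le> 2 powr (real r * \<mu>)"
      proof -
        have "2 powr (real r * \<mu>) = exp (real r * \<mu> * ln 2)" by (simp add: powr_def)
        then show ?thesis using exp_ge_add_one_self[of "real r * \<mu> * ln 2"] by linarith
      qed
      then have "pmf p a * \<tau> * b / 4 * (real r * \<mu> * ln 2) \<le> pmf p a * \<tau> * b / 4 * 2 powr (real r * \<mu>)"
        using a b \<tau> by (intro mult_left_mono) auto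
      then have "real r * q \<le> pmf p a * ?x r * \<tau> / 4" by (simp add: q_def algebra_simps)
      then have "exp (- (pmf p a * ?x r * \<tau> / 4)) \<le> exp (real r * (- q))" by simp
      also have "\<dots> = exp (- q) ^ r" by (rule exp_of_nat_mult)
      finally have "exp (- (pmf p a * ?x r * \<tau> / 4)) \<le> exp (- q) ^ r" .
      then show "norm (exp (- (pmf p a * ?x r * \<tau> / 2)) / exp (- (pmf p a * ?x r * \<tau> / 4))) \<le> exp (- q) ^ r"
      proof -
        have "exp (- (y / 2)) / exp (- (y / 4)) = exp (- (y / 4))" for y :: real by (simp flip: exp_diff)
        then show ?thesis using \<open>exp (- (pmf p a * ?x r * \<tau> / 4)) \<le> exp (- q) ^ r\<close> by (simp only: real_norm_def abs_exp_cancel)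
      qed
    qed
  qed auto
  \<comment> \<open>the factor \<open>1 / ln 2\<close> converts the base, \<open>2 powr \<mu>\<close> accounts for the passage from \<open>r\<close> to \<open>Suc r\<close>\<close>
  define b' where "b' = pmf p a * b * \<tau> / 4 / ln 2 / 2 powr \<mu>"
  have b': "b' * 2 powr (real (Suc r) * \<mu>) = pmf p a * ?x r * \<tau> / 4 / ln 2" for r
    by (simp add: b'_def powr_add algebra_simps)
  from Y have "AE \<omega> in M. \<forall>\<^sub>F r in sequentially. ?x r \<le> pop k (gen_ind j) (2 ^ r) (ZZ \<omega>) (VV \<omega>)
     \<longrightarrow> b' * 2 powr (real (Suc r) * \<mu>) \<le> pop k (gen_ind ?i) (2 ^ Suc r) (ZZ \<omega>) (VV \<omega>)"
  proof eventually_elim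
    case (elim \<omega>)
    then show ?case
    proof eventually_elim
      case (elim r)
      show ?case
      proof
        assume "?x r \<le> pop k (gen_ind j) (2 ^ r) (ZZ \<omega>) (VV \<omega>)"
        with elim have "2 powr (- pop k (gen_ind ?i) (2 ^ Suc r) (ZZ \<omega>) (VV \<omega>)) < exp (- (pmf p a * ?x r * \<tau> / 4))"
          by (simp only: if_True)
        then have "pmf p a * ?x r * \<tau> / 4 < pop k (gen_ind ?i) (2 ^ Suc r) (ZZ \<omega>) (VV \<omega>) * ln 2"
          by (simp add: powr_def)
        then show "b' * 2 powr (real (Suc r) * \<mu>) \<le> pop k (gen_ind ?i) (2 ^ Suc r) (ZZ \<omega>) (VV \<omega>)"
          unfolding b' by (simp add: pos_divide_le_eq)
      qed
    qed
  qed
  moreover have "b' > 0" using a b \<tau> by (simp add: b'_def)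
  ultimately show ?thesis by blast
qed

text \<open>Growth of generation \<open>j\<close> at any polynomial rate forces growth of generation \<open>1\<close> at the same rate, after
a bounded delay \<open>L\<close> on the logarithmic time scale.\<close>

definition feeds :: "nat \<Rightarrow> nat \<Rightarrow> bool" where
  "feeds k j \<longleftrightarrow> (\<forall>b>0. \<forall>\<mu>>0. \<exists>b'>0. \<exists>L. AE \<omega> in M. \<forall>\<^sub>F r in sequentially.
     b * 2 powr (real r * \<mu>) \<le> pop k (gen_ind j) (2 ^ r) (ZZ \<omega>) (VV \<omega>)
     \<longrightarrow> b' * 2 powr (real (r + L) * \<mu>) \<le> pop k (gen_ind 1) (2 ^ (r + L)) (ZZ \<omega>) (VV \<omega>))"

lemma feeds_1: "feeds k 1"
  unfolding feeds_def
proof (intro allI impI)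
  fix b \<mu> :: real assume "0 < b"
  then show "\<exists>b'>0. \<exists>L. AE \<omega> in M. \<forall>\<^sub>F r in sequentially.
     b * 2 powr (real r * \<mu>) \<le> pop k (gen_ind 1) (2 ^ r) (ZZ \<omega>) (VV \<omega>)
     \<longrightarrow> b' * 2 powr (real (r + L) * \<mu>) \<le> pop k (gen_ind 1) (2 ^ (r + L)) (ZZ \<omega>) (VV \<omega>)"
    by (intro exI[of _ b] exI[of _ 0] conjI) auto
qed

lemma feeds_step:
  assumes k: "k \<ge> 1" and a: "a \<le> j" "0 < pmf p a" and i: "feeds k (Suc (j - a))"
  shows "feeds k j"
  unfolding feeds_def
proof (intro allI impI)
  fix b \<mu> :: real assume b: "0 < b" and \<mu>: "0 < \<mu>"
  obtain b1 where b1: "b1 > 0" "AE \<omega> in M. \<forall>\<^sub>F r in sequentially. b * 2 powr (real r * \<mu>) \<le> pop k (gen_ind j) (2 ^ r) (ZZ \<omega>) (VV \<omega>)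
     \<longrightarrow> b1 * 2 powr (real (Suc r) * \<mu>) \<le> pop k (gen_ind (Suc (j - a))) (2 ^ Suc r) (ZZ \<omega>) (VV \<omega>)"
    using transfer[OF k a b \<mu>] by blast
  obtain b2 L where b2: "b2 > 0" "AE \<omega> in M. \<forall>\<^sub>F r in sequentially.
     b1 * 2 powr (real r * \<mu>) \<le> pop k (gen_ind (Suc (j - a))) (2 ^ r) (ZZ \<omega>) (VV \<omega>)
     \<longrightarrow> b2 * 2 powr (real (r + L) * \<mu>) \<le> pop k (gen_ind 1) (2 ^ (r + L)) (ZZ \<omega>) (VV \<omega>)"
    using i[unfolded feeds_def, rule_format, OF b1(1) \<mu>] by blast
  from b1(2) b2(2) have "AE \<omega> in M. \<forall>\<^sub>F r in sequentially.
     b * 2 powr (real r * \<mu>) \<le> pop k (gen_ind j) (2 ^ r) (ZZ \<omega>) (VV \<omega>)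
     \<longrightarrow> b2 * 2 powr (real (r + Suc L) * \<mu>) \<le> pop k (gen_ind 1) (2 ^ (r + Suc L)) (ZZ \<omega>) (VV \<omega>)"
  proof eventually_elim
    case (elim \<omega>)
    from eventually_sequentially_Suc[THEN iffD2, OF elim(2)] elim(1)
    show ?case by eventually_elim (simp only: add_Suc_right add_Suc, blast)
  qed
  with b2(1) show "\<exists>b'>0. \<exists>L. AE \<omega> in M. \<forall>\<^sub>F r in sequentially.
     b * 2 powr (real r * \<mu>) \<le> pop k (gen_ind j) (2 ^ r) (ZZ \<omega>) (VV \<omega>)
     \<longrightarrow> b' * 2 powr (real (r + L) * \<mu>) \<le> pop k (gen_ind 1) (2 ^ (r + L)) (ZZ \<omega>) (VV \<omega>)"
    by blast
qed

text \<open>Up to generation \<open>d\<close>, climb by step length \<open>0\<close> to \<open>d\<close> and drop from there to \<open>1\<close> by step length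
\<open>d\<close>. Above \<open>d\<close>, drop by \<open>d - 1\<close> repeatedly.\<close>

lemma feeds_all:
  assumes k: "k \<ge> 1" and p0: "0 < pmf p 0" and d: "d \<ge> 2" "0 < pmf p d" and j: "j \<ge> 1"
  shows "feeds k j"
proof -
  have low: "feeds k j" if "j \<le> d" for j
    using that
  proof (induction rule: inc_induct)
    case base
    show ?case using feeds_step[OF k order.refl d(2)] feeds_1[of k] by simp
  next
    case (step j)
    show ?case using step feeds_step[OF k _ p0, of j] by simp
  qed
  show ?thesis
  proof (induction j rule: less_induct)
    case (less j)
    show ?case
    proof (cases "j \<le> d")
      case False
      then have "feeds k (Suc (j - d))" using d by (intro less) auto
      then show ?thesis using False using feeds_step[OF k _ d(2), of j] by simp
    qed (rule low)
  qed
qed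

text \<open>At each large \<open>2 ^ r\<close> some generation \<open>j \<le> K\<close>, which may vary with \<open>r\<close>, carries a fixed fraction
of the total weight. Taking the smallest constant and the largest delay over the finitely many \<open>j\<close> removes the
dependence on \<open>j\<close>.\<close>

lemma children_lower_dyadic:
  assumes k: "k \<ge> 1" and d: "offspring p d" and \<mu>: "0 < \<mu>" "\<mu> < 1 / R_const p"
  shows "AE \<omega> in M. \<exists>b>0. \<forall>\<^sub>F r in sequentially. b * 2 powr (real r * \<mu>) \<le> pop k (gen_ind 1) (2 ^ r) (ZZ \<omega>) (VV \<omega>)"
proof -
  interpret off: offspring p d by (rule d)
  define \<kappa> where "\<kappa> = (\<mu> + 1 / R_const p) / 2"
  have \<kappa>: "0 < \<kappa>" "\<mu> < \<kappa>" "\<kappa> < 1 / R_const p" using \<mu> by (auto simp: \<kappa>_def field_simps)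
  obtain h K where h: "\<And>l. 0 \<le> h l" "0 < h 1" "h 0 = 0" "\<And>l. K < l \<Longrightarrow> h l = 0" "\<And>l. \<kappa> * h l \<le> reprod p h l"
    using off.subeigenvector[OF \<kappa>(1,3)] by metis
  define H where "H = (\<Sum>l\<le>K. h l)"
  have hH: "h l \<le> H" for l
  proof (cases "l \<le> K")
    case True then show ?thesis unfolding H_def using h(1) by (intro member_le_sum) auto
  next
    case False then show ?thesis using h(4)[of l] h(1) by (simp add: H_def sum_nonneg)
  qed
  have H: "0 < H" using hH[of 1] h(2) by linarith
  have K: "K \<ge> 1" using h(2) h(4)[of 1] by fastforce
  \<comment> \<open>one of the \<open>K\<close> generations carries at least a fraction \<open>1 / K\<close> of the weight, and \<open>H\<close> bounds \<open>h\<close>\<close>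
  define b where "b = 1 / (real K * H)"
  have b: "0 < b" using K H by (simp add: b_def)
  have pop_le: "pop k h n z v \<le> (\<Sum>j\<in>{1..K}. H * pop k (gen_ind j) n z v)" for n z v
  proof -
    have "weight h g \<le> (\<Sum>j\<in>{1..K}. H * weight (gen_ind j) g)" for g
    proof (cases g)
      case (Some l)
      show ?thesis
      proof (cases "l \<in> {1..K}")
        case True
        have "(\<Sum>j\<in>{1..K}. H * weight (gen_ind j) g) = (\<Sum>j\<in>{1..K}. if l = j then H else 0)"
          unfolding Some by (intro sum.cong) (auto simp: gen_ind_def)
        then show ?thesis using True hH[of l] Some by simp
      next
        case False
        then have "h l = 0" using h(3) h(4)[of l] by (cases "l = 0") auto
        then show ?thesis using Some H by (simp add: sum_nonneg)
      qed
    qed simp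
    then have "pop k h n z v \<le> (\<Sum>i\<le>n. \<Sum>j\<in>{1..K}. H * weight (gen_ind j) (gen k z v i))"
      unfolding pop_def by (intro sum_mono)
    also have "\<dots> = (\<Sum>j\<in>{1..K}. H * pop k (gen_ind j) n z v)"
      unfolding pop_def sum_distrib_left by (rule sum.swap)
    finally show ?thesis .
  qed
  have "\<forall>j\<in>{1..K}. \<exists>b'>0. \<exists>L. AE \<omega> in M. \<forall>\<^sub>F r in sequentially.
     b * 2 powr (real r * \<mu>) \<le> pop k (gen_ind j) (2 ^ r) (ZZ \<omega>) (VV \<omega>)
     \<longrightarrow> b' * 2 powr (real (r + L) * \<mu>) \<le> pop k (gen_ind 1) (2 ^ (r + L)) (ZZ \<omega>) (VV \<omega>)"
    using feeds_all[OF k off.p0 off.d] b \<mu>(1) unfolding feeds_def by simp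
  then obtain B where B: "\<forall>j\<in>{1..K}. 0 < B j \<and> (\<exists>L. AE \<omega> in M. \<forall>\<^sub>F r in sequentially.
     b * 2 powr (real r * \<mu>) \<le> pop k (gen_ind j) (2 ^ r) (ZZ \<omega>) (VV \<omega>)
     \<longrightarrow> B j * 2 powr (real (r + L) * \<mu>) \<le> pop k (gen_ind 1) (2 ^ (r + L)) (ZZ \<omega>) (VV \<omega>))"
    using bchoice by meson
  then have "\<forall>j\<in>{1..K}. \<exists>L. AE \<omega> in M. \<forall>\<^sub>F r in sequentially.
     b * 2 powr (real r * \<mu>) \<le> pop k (gen_ind j) (2 ^ r) (ZZ \<omega>) (VV \<omega>)
     \<longrightarrow> B j * 2 powr (real (r + L) * \<mu>) \<le> pop k (gen_ind 1) (2 ^ (r + L)) (ZZ \<omega>) (VV \<omega>)"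
    by blast
  then obtain L where "\<forall>j\<in>{1..K}. AE \<omega> in M. \<forall>\<^sub>F r in sequentially.
     b * 2 powr (real r * \<mu>) \<le> pop k (gen_ind j) (2 ^ r) (ZZ \<omega>) (VV \<omega>)
     \<longrightarrow> B j * 2 powr (real (r + L j) * \<mu>) \<le> pop k (gen_ind 1) (2 ^ (r + L j)) (ZZ \<omega>) (VV \<omega>)"
    using bchoice by meson
  with B have BL: "\<And>j. j \<in> {1..K} \<Longrightarrow> 0 < B j"
    "\<And>j. j \<in> {1..K} \<Longrightarrow> AE \<omega> in M. \<forall>\<^sub>F r in sequentially.
     b * 2 powr (real r * \<mu>) \<le> pop k (gen_ind j) (2 ^ r) (ZZ \<omega>) (VV \<omega>)
     \<longrightarrow> B j * 2 powr (real (r + L j) * \<mu>) \<le> pop k (gen_ind 1) (2 ^ (r + L j)) (ZZ \<omega>) (VV \<omega>)"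
    by blast+
  define \<beta> where "\<beta> = Min (B ` {1..K})"
  have \<beta>: "0 < \<beta>" "\<And>j. j \<in> {1..K} \<Longrightarrow> \<beta> \<le> B j" using BL(1) K by (auto simp: \<beta>_def)
  define \<Lambda> where "\<Lambda> = Max (L ` {1..K})"
  have \<Lambda>: "\<And>j. j \<in> {1..K} \<Longrightarrow> L j \<le> \<Lambda>" by (auto simp: \<Lambda>_def)
  have "AE \<omega> in M. \<forall>j\<in>{1..K}. \<forall>\<^sub>F r in sequentially.
     b * 2 powr (real r * \<mu>) \<le> pop k (gen_ind j) (2 ^ r) (ZZ \<omega>) (VV \<omega>)
     \<longrightarrow> B j * 2 powr (real (r + L j) * \<mu>) \<le> pop k (gen_ind 1) (2 ^ (r + L j)) (ZZ \<omega>) (VV \<omega>)"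
    using BL(2) by (subst AE_ball_countable) auto
  moreover have "AE \<omega> in M. \<forall>\<^sub>F r in sequentially. 2 powr (real r * \<mu>) < pop k h (2 ^ r) (ZZ \<omega>) (VV \<omega>)"
    by (rule lower_dyadic[OF k off.p0 \<mu>(1) \<kappa>(2) h(1) hH h(2,5)])
  ultimately show ?thesis
  proof eventually_elim
    case (elim \<omega>)
    have "\<forall>\<^sub>F r in sequentially. \<forall>j\<in>{1..K}. 
     b * 2 powr (real r * \<mu>) \<le> pop k (gen_ind j) (2 ^ r) (ZZ \<omega>) (VV \<omega>)
     \<longrightarrow> B j * 2 powr (real (r + L j) * \<mu>) \<le> pop k (gen_ind 1) (2 ^ (r + L j)) (ZZ \<omega>) (VV \<omega>)"
      using elim(1) by (intro eventually_ball_finite) auto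
    with elim(2) have "\<forall>\<^sub>F r in sequentially. \<beta> / 2 powr (real \<Lambda> * \<mu>) * 2 powr (real (r + \<Lambda>) * \<mu>) \<le> pop k (gen_ind 1) (2 ^ (r + \<Lambda>)) (ZZ \<omega>) (VV \<omega>)"
    proof eventually_elim
      case (elim r)
      have "\<exists>j\<in>{1..K}. b * 2 powr (real r * \<mu>) \<le> pop k (gen_ind j) (2 ^ r) (ZZ \<omega>) (VV \<omega>)"
      proof (rule ccontr)
        assume "\<not> ?thesis"
        then have "(\<Sum>j\<in>{1..K}. H * pop k (gen_ind j) (2 ^ r) (ZZ \<omega>) (VV \<omega>)) \<le> (\<Sum>j\<in>{1..K}. H * (b * 2 powr (real r * \<mu>)))"
          using H by (intro sum_mono mult_left_mono) (meson linear, simp)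
        also have "\<dots> = 2 powr (real r * \<mu>)" using K H by (simp add: b_def)
        finally show False using pop_le[of "2 ^ r" "ZZ \<omega>" "VV \<omega>"] elim(1) by linarith
      qed
      then obtain j where j: "j \<in> {1..K}" "B j * 2 powr (real (r + L j) * \<mu>) \<le> pop k (gen_ind 1) (2 ^ (r + L j)) (ZZ \<omega>) (VV \<omega>)"
        using elim(2) by blast
      have "\<beta> / 2 powr (real \<Lambda> * \<mu>) * 2 powr (real (r + \<Lambda>) * \<mu>) = \<beta> * 2 powr (real r * \<mu>)"
        by (simp add: distrib_right powr_add)
      also have "\<dots> \<le> B j * 2 powr (real (r + L j) * \<mu>)"
        using \<beta> j(1) \<mu> less_imp_le[OF BL(1)[OF j(1)]] by (intro mult_mono powr_mono mult_right_mono) auto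
      also note j(2)
      also have "pop k (gen_ind 1) (2 ^ (r + L j)) (ZZ \<omega>) (VV \<omega>) \<le> pop k (gen_ind 1) (2 ^ (r + \<Lambda>)) (ZZ \<omega>) (VV \<omega>)"
        using \<Lambda>[OF j(1)] by (intro pop_mono power_increasing) auto
      finally show ?case .
    qed
    then have "\<forall>\<^sub>F r in sequentially. \<beta> / 2 powr (real \<Lambda> * \<mu>) * 2 powr (real r * \<mu>) \<le> pop k (gen_ind 1) (2 ^ r) (ZZ \<omega>) (VV \<omega>)"
      by (rule eventually_sequentially_seg[THEN iffD1])
    then show ?case using \<beta>(1) by (intro exI[of _ "\<beta> / 2 powr (real \<Lambda> * \<mu>)"] conjI) auto
  qed
qed

end

section \<open>Growth of the degree\<close>

lemma ex_dyadic:
  fixes n :: nat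
  assumes "n \<ge> 1" shows "\<exists>r. 2 ^ r \<le> n \<and> n < 2 ^ Suc r"
  using ex_power_ivl1[OF order.refl assms] by (simp only: Suc_eq_plus1)

lemma eventually_dyadic:
  assumes ev: "\<forall>\<^sub>F r in sequentially. P r"
    and Q: "\<And>r n. P r \<Longrightarrow> 2 ^ r \<le> n \<Longrightarrow> n < 2 ^ Suc r \<Longrightarrow> Q n"
  shows "\<forall>\<^sub>F n in sequentially. Q n"
proof -
  obtain r0 where r0: "\<And>r. r \<ge> r0 \<Longrightarrow> P r" using ev by (auto simp: eventually_sequentially)
  have "Q n" if n: "n \<ge> 2 ^ r0" for n
  proof -
    have "n \<ge> 1" using n by (metis le_trans one_le_numeral one_le_power)
    then obtain r where r: "2 ^ r \<le> n" "n < 2 ^ Suc r" using ex_dyadic by blast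
    have "(2::nat) ^ r0 < 2 ^ Suc r" using n r(2) by linarith
    then have "r0 < Suc r" by (rule power_less_imp_less_exp[rotated]) simp
    then show ?thesis using Q[OF r0 r] by simp
  qed
  then show ?thesis by (auto simp: eventually_sequentially)
qed

lemma log_ratio_tendsto_0:
  fixes \<delta> :: real
  assumes "0 < \<delta>"
  shows "((\<lambda>x::real. (1 + ln x / ln 2) powr (1 + \<delta> / 2) / ln x powr (1 + \<delta>)) \<longlongrightarrow> 0) at_top"
  using assms by real_asymp

lemma inverse_tendsto_0:
  fixes \<gamma> \<delta> :: real
  assumes "0 < \<gamma>" "0 < \<delta>"
  shows "((\<lambda>x::real. 1 / (x powr \<gamma> * ln x powr (1 + \<delta>))) \<longlongrightarrow> 0) at_top"
  using assms by real_asymp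

context random_tree_model
begin

lemma children_lower:
  assumes k: "k \<ge> 1" and d: "offspring p d" and \<mu>: "0 < \<mu>" "\<mu> < 1 / R_const p"
  shows "AE \<omega> in M. \<exists>b>0. \<forall>\<^sub>F n in sequentially. b * real n powr \<mu> \<le> pop k (gen_ind 1) n (ZZ \<omega>) (VV \<omega>)"
  using children_lower_dyadic[OF assms]
proof eventually_elim
  case (elim \<omega>)
  then obtain b where b: "b > 0" "\<forall>\<^sub>F r in sequentially. b * 2 powr (real r * \<mu>) \<le> pop k (gen_ind 1) (2 ^ r) (ZZ \<omega>) (VV \<omega>)"
    by blast
  have "\<forall>\<^sub>F n in sequentially. b / 2 powr \<mu> * real n powr \<mu> \<le> pop k (gen_ind 1) n (ZZ \<omega>) (VV \<omega>)"
  proof (rule eventually_dyadic[OF b(2)])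
    fix r n :: nat assume *: "b * 2 powr (real r * \<mu>) \<le> pop k (gen_ind 1) (2 ^ r) (ZZ \<omega>) (VV \<omega>)" "2 ^ r \<le> n" "n < 2 ^ Suc r"
    have "real n \<le> 2 ^ Suc r" using *(3) by (metis less_imp_le of_nat_le_iff of_nat_numeral of_nat_power)
    then have "real n powr \<mu> \<le> (2 ^ Suc r) powr \<mu>" using \<mu> by (intro powr_mono2) auto
    also have "(2 ^ Suc r) powr \<mu> = 2 powr (real (Suc r) * \<mu>)"
      by (simp only: powr_powr flip: powr_realpow[of 2])
    also have "\<dots> = 2 powr \<mu> * 2 powr (real r * \<mu>)" by (simp add: distrib_right powr_add)
    finally have "b / 2 powr \<mu> * real n powr \<mu> \<le> b * 2 powr (real r * \<mu>)" using b(1) by (simp add: field_simps)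
    also note *(1)
    also have "pop k (gen_ind 1) (2 ^ r) (ZZ \<omega>) (VV \<omega>) \<le> pop k (gen_ind 1) n (ZZ \<omega>) (VV \<omega>)"
      using *(2) by (intro pop_mono) auto
    finally show "b / 2 powr \<mu> * real n powr \<mu> \<le> pop k (gen_ind 1) n (ZZ \<omega>) (VV \<omega>)" .
  qed
  then show ?case using b(1) by (intro exI[of _ "b / 2 powr \<mu>"]) auto
qed

text \<open>The weight \<open>(1 / s) ^ l\<close> gives each child weight \<open>1 / s\<close>, so the children are at most \<open>s\<close> times the
weighted population.\<close>

lemma children_upper:
  assumes k: "k \<ge> 1" and d: "offspring p d" and \<epsilon>: "0 < \<epsilon>"
  shows "\<exists>C>0. AE \<omega> in M. \<forall>\<^sub>F n in sequentially. pop k (gen_ind 1) n (ZZ \<omega>) (VV \<omega>)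
     \<le> C * (real n powr (1 / R_const p) * (1 + ln (real n) / ln 2) powr (1 + \<epsilon>))"
proof -
  interpret off: offspring p d by (rule d)
  let ?\<gamma> = "1 / R_const p"
  have \<gamma>: "0 < ?\<gamma>" using off.R_const_props(1) by simp
  obtain s where s: "s > 0" "\<And>l. reprod p (\<lambda>l. (1 / s) ^ l) l \<le> ?\<gamma> * (1 / s) ^ l"
    using off.supereigenvector by blast
  let ?h = "\<lambda>l. (1 / s) ^ l"
  have "AE \<omega> in M. \<forall>\<^sub>F r in sequentially. pop k ?h (2 ^ r) (ZZ \<omega>) (VV \<omega>) < 2 powr (real r * ?\<gamma>) * real r powr (1 + \<epsilon>)"
    by (rule upper_dyadic[OF k \<gamma> \<epsilon> _ _ s(2)]) (use s in auto)
  then have "AE \<omega> in M. \<forall>\<^sub>F n in sequentially. pop k (gen_ind 1) n (ZZ \<omega>) (VV \<omega>)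
     \<le> (s * 2 powr ?\<gamma>) * (real n powr ?\<gamma> * (1 + ln (real n) / ln 2) powr (1 + \<epsilon>))"
  proof eventually_elim
    case (elim \<omega>)
    have "\<forall>\<^sub>F r in sequentially. pop k ?h (2 ^ Suc r) (ZZ \<omega>) (VV \<omega>) < 2 powr (real (Suc r) * ?\<gamma>) * real (Suc r) powr (1 + \<epsilon>)"
      using eventually_sequentially_Suc[THEN iffD2, OF elim] .
    then show ?case
    proof (rule eventually_dyadic)
      fix r n :: nat assume *: "pop k ?h (2 ^ Suc r) (ZZ \<omega>) (VV \<omega>) < 2 powr (real (Suc r) * ?\<gamma>) * real (Suc r) powr (1 + \<epsilon>)"
        "2 ^ r \<le> n" "n < 2 ^ Suc r"
      have n2: "2 ^ r \<le> real n" using *(2) by (metis of_nat_le_iff of_nat_numeral of_nat_power)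
      have n0: "0 < real n" using n2 by (meson less_le_trans zero_less_numeral zero_less_power)
      have "real r * ln 2 \<le> ln (real n)"
        using n2 n0 by (simp flip: ln_realpow)
      then have lr: "real (Suc r) \<le> 1 + ln (real n) / ln 2" by (simp add: field_simps)
      have "pop k (gen_ind 1) n (ZZ \<omega>) (VV \<omega>) \<le> pop k (gen_ind 1) (2 ^ Suc r) (ZZ \<omega>) (VV \<omega>)"
        using *(3) by (intro pop_mono) auto
      also have "\<dots> \<le> s * pop k ?h (2 ^ Suc r) (ZZ \<omega>) (VV \<omega>)"
        unfolding pop_cmult[symmetric] using s by (intro pop_weight_mono) (auto simp: gen_ind_def)
      also have "\<dots> \<le> s * (2 powr (real (Suc r) * ?\<gamma>) * real (Suc r) powr (1 + \<epsilon>))"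
        using * s by (intro mult_left_mono) auto
      also have "2 powr (real (Suc r) * ?\<gamma>) = 2 powr ?\<gamma> * (2 ^ r) powr ?\<gamma>"
      proof -
        have "(2 ^ r) powr ?\<gamma> = 2 powr (real r * ?\<gamma>)" by (simp only: powr_powr flip: powr_realpow[of 2])
        then show ?thesis by (simp add: distrib_right powr_add add_divide_distrib)
      qed
      also have "s * (2 powr ?\<gamma> * (2 ^ r) powr ?\<gamma> * real (Suc r) powr (1 + \<epsilon>))
        \<le> s * (2 powr ?\<gamma> * real n powr ?\<gamma> * (1 + ln (real n) / ln 2) powr (1 + \<epsilon>))"
        using s n2 lr \<gamma> \<epsilon> by (intro mult_left_mono mult_mono powr_mono2) auto
      finally show "pop k (gen_ind 1) n (ZZ \<omega>) (VV \<omega>)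
        \<le> (s * 2 powr ?\<gamma>) * (real n powr ?\<gamma> * (1 + ln (real n) / ln 2) powr (1 + \<epsilon>))" by (simp add: mult.assoc)
    qed
  qed
  then show ?thesis using s by (intro exI[of _ "s * 2 powr ?\<gamma>"]) auto
qed

text \<open>Outside this event the edge set need not be a tree.\<close>

lemma AE_V_le: "AE \<omega> in M. \<forall>i\<ge>1. V i \<omega> \<le> i"
proof -
  have "AE \<omega> in M. i \<ge> 1 \<longrightarrow> V i \<omega> \<le> i" for i
  proof (cases "i \<ge> 1")
    case True
    have "AE x in distr M (count_space UNIV) (V i). x \<le> i"
      unfolding law_V[OF True] by (auto simp: AE_measure_pmf_iff)
    then show ?thesis using rv_V[OF True] by (simp add: AE_distr_iff)
  qed simp
  then show ?thesis by (simp add: AE_all_countable)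
qed

lemma degree_eq_children:
  assumes k: "k \<ge> 1"
  shows "AE \<omega> in M. \<forall>n\<ge>k. real (vertex_degree (tree_edges (ZZ \<omega>) (VV \<omega>) n) k) = 1 + pop k (gen_ind 1) n (ZZ \<omega>) (VV \<omega>)"
  using AE_V_le
proof eventually_elim
  case (elim \<omega>)
  show ?case
  proof (intro allI impI)
    fix n assume n: "k \<le> n"
    have "weight (gen_ind 1) g = (if g = Some 1 then 1 else 0)" for g
      by (cases g) (auto simp: gen_ind_def)
    then have "pop k (gen_ind 1) n (ZZ \<omega>) (VV \<omega>) = real (card {i\<in>{..n}. gen k (ZZ \<omega>) (VV \<omega>) i = Some 1})"
      unfolding pop_def by (simp add: sum.If_cases Int_def)
    moreover have "vertex_degree (tree_edges (ZZ \<omega>) (VV \<omega>) n) k = Suc (card {i\<in>{..n}. gen k (ZZ \<omega>) (VV \<omega>) i = Some 1})"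
      by (rule vertex_degree_eq[OF _ k n]) (use elim in auto)
    ultimately show "real (vertex_degree (tree_edges (ZZ \<omega>) (VV \<omega>) n) k) = 1 + pop k (gen_ind 1) n (ZZ \<omega>) (VV \<omega>)" by simp
  qed
qed

end

theorem theorem3p10:
  fixes M :: "'a measure" and p :: "nat pmf" and Z V :: "nat \<Rightarrow> 'a \<Rightarrow> nat"
    and k :: nat and \<delta> :: real
  assumes "random_tree_model M p Z V"
    and "integrable (measure_pmf p) real"
    and "0 < pmf p 0" and "pmf p 0 < 1"
    and "pmf p 0 + pmf p 1 < 1"
    and "Gcd {j. pmf p j > 0} = 1"
    and "k \<ge> 1"
    and "\<delta> > 0"
  defines "deg \<equiv> \<lambda>\<omega> n. real (vertex_degree (tree_edges (\<lambda>i. Z i \<omega>) (\<lambda>i. V i \<omega>) n) k)"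
  shows "(AE \<omega> in M. filterlim (\<lambda>n. deg \<omega> n / real n powr (1 / R_const p - \<delta>)) at_top sequentially)
    \<and> (AE \<omega> in M. (\<lambda>n. deg \<omega> n / (real n powr (1 / R_const p) * ln (real n) powr (1 + \<delta>)))
          \<longlonglongrightarrow> 0)"
proof -
  interpret random_tree_model M p Z V by (rule assms(1))
  note k = \<open>k \<ge> 1\<close> and \<delta> = \<open>\<delta> > 0\<close>
  let ?\<gamma> = "1 / R_const p"
  \<comment> \<open>the mass outside \<open>0\<close> and \<open>1\<close> provides the step length \<open>d\<close>\<close>
  have "\<exists>d\<ge>2. 0 < pmf p d"
  proof (rule ccontr)
    assume "\<not> ?thesis"
    then have "x = 0 \<or> x = 1" if "x \<in> set_pmf p" for x
      using pmf_positive[OF that] by (metis less_2_cases_iff not_le One_nat_def)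
    then have "set_pmf p \<subseteq> {0, 1}" by blast
    then have "measure p {0, 1} = 1" by (simp add: measure_pmf.prob_eq_1 AE_measure_pmf_iff subset_iff)
    then show False using assms(5) by (simp add: measure_measure_pmf_finite)
  qed
  then obtain d where "d \<ge> 2" "0 < pmf p d" by blast
  then have off: "offspring p d" using assms(3) by unfold_locales
  have \<gamma>: "0 < ?\<gamma>" using offspring.R_const_props(1)[OF off] by simp
  have deg: "AE \<omega> in M. \<forall>n\<ge>k. deg \<omega> n = 1 + pop k (gen_ind 1) n (\<lambda>i. Z i \<omega>) (\<lambda>i. V i \<omega>)"
    unfolding deg_def by (rule degree_eq_children[OF k])
  show ?thesis
  proof
    \<comment> \<open>an exponent strictly between \<open>1 / R - \<delta>\<close> and \<open>1 / R\<close> that is positive, as \<open>1 / R - \<delta>\<close> may be negative\<close>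
    define \<mu> where "\<mu> = max (?\<gamma> - \<delta> / 2) (?\<gamma> / 2)"
    have "0 < max (g - \<delta> / 2) (g / 2) \<and> max (g - \<delta> / 2) (g / 2) < g \<and> g - \<delta> < max (g - \<delta> / 2) (g / 2)"
      if "0 < g" for g :: real using that \<delta> by (auto simp: max_def)
    from this[OF \<gamma>] have \<mu>: "0 < \<mu>" "\<mu> < ?\<gamma>" "?\<gamma> - \<delta> < \<mu>" by (simp_all only: \<mu>_def)
    from deg children_lower[OF k off \<mu>(1,2)]
    show "AE \<omega> in M. filterlim (\<lambda>n. deg \<omega> n / real n powr (?\<gamma> - \<delta>)) at_top sequentially"
    proof eventually_elim
      case (elim \<omega>)
      note dg = elim(1)
      from elim obtain b where b: "b > 0" "\<forall>\<^sub>F n in sequentially. b * real n powr \<mu> \<le> pop k (gen_ind 1) n (\<lambda>i. Z i \<omega>) (\<lambda>i. V i \<omega>)"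
        by blast
      have "filterlim (\<lambda>n. real n powr (\<mu> - (?\<gamma> - \<delta>))) at_top sequentially"
        using \<mu> by real_asymp
      then have lim: "filterlim (\<lambda>n. b * real n powr (\<mu> - (?\<gamma> - \<delta>))) at_top sequentially"
        using b(1) by (intro filterlim_tendsto_pos_mult_at_top[OF tendsto_const])
      show ?case
      proof (rule filterlim_at_top_mono[OF lim])
        show "\<forall>\<^sub>F n in sequentially. b * real n powr (\<mu> - (?\<gamma> - \<delta>)) \<le> deg \<omega> n / real n powr (?\<gamma> - \<delta>)"
          using b(2) eventually_ge_at_top[of k]
        proof eventually_elim
          case (elim n)
          have "b * real n powr (\<mu> - (?\<gamma> - \<delta>)) = b * real n powr \<mu> / real n powr (?\<gamma> - \<delta>)"
            by (simp add: powr_diff)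
          also have "\<dots> \<le> deg \<omega> n / real n powr (?\<gamma> - \<delta>)"
            using elim dg by (intro divide_right_mono) auto
          finally show ?case .
        qed
      qed
    qed
  next
    obtain C where C: "C > 0" "AE \<omega> in M. \<forall>\<^sub>F n in sequentially. pop k (gen_ind 1) n (\<lambda>i. Z i \<omega>) (\<lambda>i. V i \<omega>)
       \<le> C * (real n powr ?\<gamma> * (1 + ln (real n) / ln 2) powr (1 + \<delta> / 2))"
      using children_upper[OF k off, of "\<delta> / 2"] \<delta> by auto
    let ?g = "\<lambda>x. 1 / (x powr ?\<gamma> * ln x powr (1 + \<delta>)) + C * ((1 + ln x / ln 2) powr (1 + \<delta> / 2) / ln x powr (1 + \<delta>))"
    have "(?g \<longlongrightarrow> 0 + C * 0) at_top"
      by (intro tendsto_intros log_ratio_tendsto_0 inverse_tendsto_0 \<gamma> \<delta>)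
    then have lim: "(\<lambda>n. ?g (real n)) \<longlonglongrightarrow> 0"
      using filterlim_compose[OF _ filterlim_real_sequentially] by fastforce
    from deg C(2)
    show "AE \<omega> in M. (\<lambda>n. deg \<omega> n / (real n powr ?\<gamma> * ln (real n) powr (1 + \<delta>))) \<longlonglongrightarrow> 0"
    proof eventually_elim
      case (elim \<omega>)
      note dg = elim(1)
      show ?case
      proof (rule tendsto_sandwich[OF _ _ tendsto_const lim])
        show "\<forall>\<^sub>F n in sequentially. 0 \<le> deg \<omega> n / (real n powr ?\<gamma> * ln (real n) powr (1 + \<delta>))"
          by (simp add: deg_def)
        show "\<forall>\<^sub>F n in sequentially. deg \<omega> n / (real n powr ?\<gamma> * ln (real n) powr (1 + \<delta>)) \<le> ?g (real n)"
          using elim(2) eventually_ge_at_top[of k]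
        proof eventually_elim
          case (elim n)
          have n: "0 < real n" using elim k by simp
          let ?D = "real n powr ?\<gamma> * ln (real n) powr (1 + \<delta>)"
          have "deg \<omega> n / ?D \<le> (1 + C * (real n powr ?\<gamma> * (1 + ln (real n) / ln 2) powr (1 + \<delta> / 2))) / ?D"
            using elim dg by (intro divide_right_mono) auto
          also have "\<dots> = ?g (real n)" using n by (simp add: add_divide_distrib)
          finally show ?case .
        qed
      qed
    qed
  qed
qed

end
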